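(* For every $n\ge 3$ the family $\mathcal{R}_n$ is generic in the variety $\mathfrak{Nil}_n$ of all $n$-dimensional complex nilpotent algebras, i.e. $\overline{\bigcup_{\mathcal{A}\in\mathcal{R}_n}O(\mathcal{A})}=\mathfrak{Nil}_n$. Moreover, for every $n\ge 2$ the variety $\mathfrak{Nil}_n$ is irreducible and $\dim \mathfrak{Nil}_n=\frac{n(n-1)(n+1)}{3}$.
   Context: All algebras are over $\mathbb{C}$ and not necessarily associative (a vector space with a bilinear product). Fix an $n$-dimensional vector space $V$ with basis $e_1,\dots,e_n$; an algebra structure on $V$ is identified with the point $(c_{ij}^k)_{i,j,k=1}^n\in\mathbb{C}^{n^3}$ of its structure constants, $e_ie_j=\sum_k c_{ij}^k e_k$, with the Zariski topology. $\mathrm{GL}_n(\mathbb{C})$ acts by change of basis; $O(\mathcal{A})$ is the orbit of $\mathcal{A}$ (its isomorphism class). An algebra $N$ is nilpotent if $N^k=0$ for some $k$, where $N^1=N$, $N^{k+1}=\sum_{i=1}^k N^iN^{k+1-i}$. $\mathfrak{Nil}_n\subseteq\mathbb{C}^{n^3}$ is the (closed) set of nilpotent structures. A family $\mathcal{R}$ of algebras in an irreducible variety $\mathfrak{V}$ is generic if $\overline{\bigcup_{\mathcal{A}\in\mathcal{R}}O(\mathcal{A})}=\mathfrak{V}$. Condition ( * ): $c_{ij}^k=0$ whenever $k\le\max\{i,j\}$. For $n\ge3$, $\mathcal{R}_n$ is the family of algebra structures on $V$ satisfying ( * ) such that $e_i^2=e_{i+1}$ for $1\le i\le n-1$ (i.e.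 $c_{ii}^k=\delta_{k,i+1}$), $c_{21}^3=1$, $c_{1i}^{i+1}=0$ for $2\le i\le n-1$, and whose remaining structure constants $c_{ij}^k$ ($i\ne j$, $k>\max\{i,j\}$) are arbitrary independent complex parameters. *)

theory Defs
  imports Complex_Main "HOL-Library.Function_Algebras"
begin

text \<open>Vectors of V = C^n with basis e_1..e_n: functions nat => complex supported in {1..n}.
  Algebra structures: structure constants c (i,j,k) = c_ij^k, supported in {1..n}^3,
  i.e. points of C^(n^3).\<close>

type_synonym vec = "nat \<Rightarrow> complex"
type_synonym struct = "nat \<times> nat \<times> nat \<Rightarrow> complex"

definition Vsp :: "nat \<Rightarrow> vec set" where
  "Vsp n = {x. \<forall>i. i \<notin> {1..n} \<longrightarrow> x i = 0}"

definition Str :: "nat \<Rightarrow> struct set" where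
  "Str n = {c. \<forall>i j k. \<not> (i \<in> {1..n} \<and> j \<in> {1..n} \<and> k \<in> {1..n}) \<longrightarrow> c (i, j, k) = 0}"

definition amult :: "nat \<Rightarrow> struct \<Rightarrow> vec \<Rightarrow> vec \<Rightarrow> vec" where
  "amult n c x y = (\<lambda>k. \<Sum>i\<in>{1..n}. \<Sum>j\<in>{1..n}. x i * y j * c (i, j, k))"

text \<open>Powers N^k: pw n c k x means x \<in> N^k, where N^1 = V and
  N^(k) = sum over i+j=k (i,j \<ge> 1) of span(N^i N^j).\<close>
inductive pw :: "nat \<Rightarrow> struct \<Rightarrow> nat \<Rightarrow> vec \<Rightarrow> bool" for n c where
  base: "x \<in> Vsp n \<Longrightarrow> pw n c 1 x"
| zero: "k \<ge> 1 \<Longrightarrow> pw n c k 0"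
| prod: "pw n c i x \<Longrightarrow> pw n c j y \<Longrightarrow> pw n c (i + j) (amult n c x y)"
| add: "pw n c k x \<Longrightarrow> pw n c k y \<Longrightarrow> pw n c k (x + y)"
| smult: "pw n c k x \<Longrightarrow> pw n c k (\<lambda>t. a * x t)"

definition nilpotent_str :: "nat \<Rightarrow> struct \<Rightarrow> bool" where
  "nilpotent_str n c \<longleftrightarrow> (\<exists>k\<ge>1. \<forall>x. pw n c k x \<longrightarrow> x = 0)"

definition NilVar :: "nat \<Rightarrow> struct set" where
  "NilVar n = {c \<in> Str n. nilpotent_str n c}"

definition orbit :: "nat \<Rightarrow> struct \<Rightarrow> struct set" where
  "orbit n c = {c' \<in> Str n. \<exists>\<phi>. bij_betw \<phi> (Vsp n) (Vsp n)
      \<and> (\<forall>x\<in>Vsp n. \<forall>y\<in>Vsp n. \<phi> (x + y) = \<phi> x + \<phi> y)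
      \<and> (\<forall>a. \<forall>x\<in>Vsp n. \<phi> (\<lambda>t. a * x t) = (\<lambda>t. a * \<phi> x t))
      \<and> (\<forall>x\<in>Vsp n. \<forall>y\<in>Vsp n. \<phi> (amult n c x y) = amult n c' (\<phi> x) (\<phi> y))}"

inductive_set polyfun :: "(struct \<Rightarrow> complex) set" where
  pconst: "(\<lambda>_. a) \<in> polyfun"
| pvar: "(\<lambda>c. c v) \<in> polyfun"
| padd: "p \<in> polyfun \<Longrightarrow> q \<in> polyfun \<Longrightarrow> (\<lambda>c. p c + q c) \<in> polyfun"
| pmult: "p \<in> polyfun \<Longrightarrow> q \<in> polyfun \<Longrightarrow> (\<lambda>c. p c * q c) \<in> polyfun"

definition zclosed :: "nat \<Rightarrow> struct set \<Rightarrow> bool" where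
  "zclosed n Z \<longleftrightarrow> (\<exists>P \<subseteq> polyfun. Z = {c \<in> Str n. \<forall>p\<in>P. p c = 0})"

definition zclosure :: "nat \<Rightarrow> struct set \<Rightarrow> struct set" where
  "zclosure n S = \<Inter>{Z. zclosed n Z \<and> S \<subseteq> Z}"

definition zirreducible :: "nat \<Rightarrow> struct set \<Rightarrow> bool" where
  "zirreducible n X \<longleftrightarrow> X \<noteq> {} \<and>
     (\<forall>Z1 Z2. zclosed n Z1 \<and> zclosed n Z2 \<and> X \<subseteq> Z1 \<union> Z2 \<longrightarrow> X \<subseteq> Z1 \<or> X \<subseteq> Z2)"

definition zchain :: "nat \<Rightarrow> struct set \<Rightarrow> nat \<Rightarrow> bool" where
  "zchain n X m \<longleftrightarrow> (\<exists>Z :: nat \<Rightarrow> struct set.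
      (\<forall>i\<le>m. zclosed n (Z i) \<and> zirreducible n (Z i) \<and> Z i \<subseteq> X)
      \<and> (\<forall>i<m. Z i \<subset> Z (Suc i)))"

definition has_zdim :: "nat \<Rightarrow> struct set \<Rightarrow> nat \<Rightarrow> bool" where
  "has_zdim n X d \<longleftrightarrow> zchain n X d \<and> \<not> zchain n X (Suc d)"

definition generic :: "nat \<Rightarrow> struct set \<Rightarrow> struct set \<Rightarrow> bool" where
  "generic n R W \<longleftrightarrow> zclosure n (\<Union>c\<in>R. orbit n c) = W"

definition Rfam :: "nat \<Rightarrow> struct set" where
  "Rfam n = {c \<in> Str n.
     (\<forall>i j k. k \<le> max i j \<longrightarrow> c (i, j, k) = 0)
     \<and> (\<forall>i k. 1 \<le> i \<and> i \<le> n - 1 \<longrightarrow> c (i, i, k) = (if k = i + 1 then 1 else 0))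
     \<and> c (2, 1, 3) = 1
     \<and> (\<forall>i. 2 \<le> i \<and> i \<le> n - 1 \<longrightarrow> c (1, i, i + 1) = 0)}"

end

theory Submission
  imports Defs "HOL-Computational_Algebra.Polynomial" "HOL-Library.FuncSet"
begin

text \<open>A nilpotent structure becomes triangular after a product of column
  transvections, one for each column of a unitriangular matrix; where a pivot vanishes, a small
  perturbation creates one. Hence the nilpotent variety is the closure of the image of the polynomial map
  \<open>\<Phi> (u, c) = u \<cdot> c\<close> from unitriangular matrices times triangular structures, an affine space of
  dimension \<open>n (n - 1) / 2 + n (n - 1) (2 n - 1) / 6 = n (n - 1) (n + 1) / 3\<close>; in particular it is
  irreducible. Functions separating the members of a chain of irreducible closed sets are
  algebraically independent, so counting monomials bounds the length of a chain by that dimension.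
  Freeing the coordinates of the affine space one at a time, with the matrix columns in increasing
  order, gives a chain of exactly this length: the coordinates of \<open>e\<^sub>1 (e\<^sub>1 (\<dots> e\<^sub>1))\<close> detect
  each new matrix entry. Finally a triangular structure outside a hypersurface is isomorphic to a
  member of \<^const>\<open>Rfam\<close> via a basis of iterated squares \<open>f\<^sub>i\<^sub>+\<^sub>1 = f\<^sub>i\<^sup>2\<close>.\<close>

subsection \<open>Bilinear products and isomorphisms\<close>

text \<open>Triangular means adapted to the flag
  \<open>Tail 1 \<supseteq> Tail 2 \<supseteq> ...\<close>, which lower triangular matrices
  preserve. They map \<open>tri n\<close> to itself, so only their cosets in the general linear
  group matter, and the upper unitriangular matrices represent a dense set of cosets; hence the
  parameter count is the dimension of the flag variety plus that of \<open>tri n\<close>. Dense is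
  not everything: a nilpotent structure need not lie in the image of \<open>\<Phi>\<close>, so the
  reduction argues about polynomials vanishing on the image instead of producing a preimage. A
  second obstacle is that the exponent in the definition of nilpotency depends on the structure, so
  closedness of the nilpotent set is not apparent. Both are met by one induction principle with an
  arbitrary predicate, \<open>nilpotent_triangularize\<close>, applied once to the uniform exponent
  \<open>2 ^ n\<close> and once to the vanishing of polynomials. The exponent is a power of two
  because brackets may be balanced: in a triangular algebra, doubling the number of factors is only
  guaranteed to gain one step of the flag.\<close>

definition evec :: "nat \<Rightarrow> vec" where
  "evec i = (\<lambda>t. if t = i then 1 else 0)"

lemma evec_apply: "evec i t = (if t = i then 1 else 0)"
  by (simp add: evec_def)

lemma VspI: "(\<And>i. i \<notin> {1..n} \<Longrightarrow> x i = 0) \<Longrightarrow> x \<in> Vsp n"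
  by (simp add: Vsp_def)

lemma VspD: "x \<in> Vsp n \<Longrightarrow> i \<notin> {1..n} \<Longrightarrow> x i = 0"
  by (simp add: Vsp_def)

lemma evec_Vsp [simp]: "i \<in> {1..n} \<Longrightarrow> evec i \<in> Vsp n"
  by (auto simp: Vsp_def evec_def)

lemma zero_Vsp [simp]: "0 \<in> Vsp n"
  by (simp add: Vsp_def)

lemma add_Vsp [simp]: "x \<in> Vsp n \<Longrightarrow> y \<in> Vsp n \<Longrightarrow> x + y \<in> Vsp n"
  by (simp add: Vsp_def)

lemma scale_Vsp [simp]: "x \<in> Vsp n \<Longrightarrow> (\<lambda>t. a * x t) \<in> Vsp n"
  by (simp add: Vsp_def)

lemma StrD: "c \<in> Str n \<Longrightarrow> i \<notin> {1..n} \<or> j \<notin> {1..n} \<or> k \<notin> {1..n} \<Longrightarrow> c (i, j, k) = 0"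
  unfolding Str_def by blast

lemma StrI:
  "(\<And>i j k. i \<notin> {1..n} \<or> j \<notin> {1..n} \<or> k \<notin> {1..n} \<Longrightarrow> c (i, j, k) = 0) \<Longrightarrow> c \<in> Str n"
  unfolding Str_def by blast

lemma amult_Vsp [simp]: "c \<in> Str n \<Longrightarrow> amult n c x y \<in> Vsp n"
  by (rule VspI) (simp add: amult_def StrD)

lemma amult_evec:
  "i \<in> {1..n} \<Longrightarrow> j \<in> {1..n} \<Longrightarrow> amult n c (evec i) (evec j) = (\<lambda>k. c (i, j, k))"
  by (rule ext) (simp add: amult_def evec_apply sum.delta if_distrib[of "\<lambda>x. x * _"] if_distrib[of "\<lambda>x. _ * x"] cong: if_cong)

lemma amult_add_left: "amult n c (x + y) z = amult n c x z + amult n c y z"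
  by (rule ext) (simp add: amult_def sum.distrib algebra_simps)

lemma amult_add_right: "amult n c z (x + y) = amult n c z x + amult n c z y"
  by (rule ext) (simp add: amult_def sum.distrib algebra_simps)

lemma amult_scale_left: "amult n c (\<lambda>t. a * x t) z = (\<lambda>t. a * amult n c x z t)"
  by (rule ext) (simp add: amult_def sum_distrib_left algebra_simps)

lemma amult_scale_right: "amult n c z (\<lambda>t. a * x t) = (\<lambda>t. a * amult n c z x t)"
  by (rule ext) (simp add: amult_def sum_distrib_left algebra_simps)

definition linmap :: "nat \<Rightarrow> (vec \<Rightarrow> vec) \<Rightarrow> bool" where
  "linmap n \<phi> \<longleftrightarrow> (\<forall>x\<in>Vsp n. \<phi> x \<in> Vsp n)
     \<and> (\<forall>x\<in>Vsp n. \<forall>y\<in>Vsp n. \<phi> (x + y) = \<phi> x + \<phi> y)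
     \<and> (\<forall>a. \<forall>x\<in>Vsp n. \<phi> (\<lambda>t. a * x t) = (\<lambda>t. a * \<phi> x t))"

lemma linmapD:
  assumes "linmap n \<phi>"
  shows "x \<in> Vsp n \<Longrightarrow> \<phi> x \<in> Vsp n"
    and "x \<in> Vsp n \<Longrightarrow> y \<in> Vsp n \<Longrightarrow> \<phi> (x + y) = \<phi> x + \<phi> y"
    and "x \<in> Vsp n \<Longrightarrow> \<phi> (\<lambda>t. a * x t) = (\<lambda>t. a * \<phi> x t)"
  using assms by (auto simp: linmap_def)

lemma linmap_zero: "linmap n \<phi> \<Longrightarrow> \<phi> 0 = 0"
  using linmapD(3)[of n \<phi> 0 0] by (simp add: zero_fun_def[symmetric])

text \<open>Stated for an arbitrary \<open>F\<close> rather than for \<open>linmap\<close>, so that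
  it applies directly to a bilinear expression with one argument fixed.\<close>

lemma linear_expand:
  fixes F :: "vec \<Rightarrow> vec"
  assumes add: "\<And>x y. x \<in> Vsp n \<Longrightarrow> y \<in> Vsp n \<Longrightarrow> F (x + y) = F x + F y"
    and scale: "\<And>a x. x \<in> Vsp n \<Longrightarrow> F (\<lambda>t. a * x t) = (\<lambda>t. a * F x t)"
    and x: "x \<in> Vsp n"
  shows "F x m = (\<Sum>i\<in>{1..n}. x i * F (evec i) m)"
proof -
  have F0: "F 0 = 0"
    using scale[of 0 0] by (simp add: zero_fun_def[symmetric])
  have *: "(\<lambda>t. if t \<in> A then x t else 0) \<in> Vsp n \<and>
      F (\<lambda>t. if t \<in> A then x t else 0) m = (\<Sum>i\<in>A. x i * F (evec i) m)"
    if "finite A" "A \<subseteq> {1..n}" for A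
    using that
  proof (induction A)
    case empty
    then show ?case using F0 by (simp add: zero_fun_def[symmetric])
  next
    case (insert a A)
    then have IH: "(\<lambda>t. if t \<in> A then x t else 0) \<in> Vsp n"
      "F (\<lambda>t. if t \<in> A then x t else 0) m = (\<Sum>i\<in>A. x i * F (evec i) m)" by auto
    have e: "evec a \<in> Vsp n" using insert by auto
    have eq: "(\<lambda>t. if t \<in> insert a A then x t else 0)
        = (\<lambda>t. if t \<in> A then x t else 0) + (\<lambda>t. x a * evec a t)"
      using insert by (auto simp: fun_eq_iff evec_apply)
    have mem: "(\<lambda>t. x a * evec a t) \<in> Vsp n" using e by (rule scale_Vsp)
    show ?case
      unfolding eq using insert IH add[OF IH(1) mem] scale[OF e] add_Vsp[OF IH(1) mem]
      by simp
  qed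
  have "(\<lambda>t. if t \<in> {1..n} then x t else 0) = x"
    using VspD[OF x] by (auto simp: fun_eq_iff)
  with *[of "{1..n}"] show ?thesis by simp
qed

text \<open>For \<open>\<psi>\<close> inverse to \<open>\<phi>\<close> this is the change of basis
  action. Passing the inverse explicitly keeps the result polynomial in the data whenever the
  inverse is known in closed form.\<close>

definition transport :: "nat \<Rightarrow> (vec \<Rightarrow> vec) \<Rightarrow> (vec \<Rightarrow> vec) \<Rightarrow> struct \<Rightarrow> struct" where
  "transport n \<phi> \<psi> c = (\<lambda>(i, j, m). if i \<in> {1..n} \<and> j \<in> {1..n} \<and> m \<in> {1..n}
     then \<phi> (amult n c (\<psi> (evec i)) (\<psi> (evec j))) m else 0)"

lemma transport_Str [simp]: "transport n \<phi> \<psi> c \<in> Str n"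
  by (rule StrI) (auto simp: transport_def)

lemma amult_transport:
  assumes \<phi>: "linmap n \<phi>" and \<psi>: "linmap n \<psi>" and c: "c \<in> Str n"
    and x: "x \<in> Vsp n" and y: "y \<in> Vsp n"
  shows "amult n (transport n \<phi> \<psi> c) x y = \<phi> (amult n c (\<psi> x) (\<psi> y))"
proof
  fix m
  let ?B = "\<lambda>x y. \<phi> (amult n c (\<psi> x) (\<psi> y))"
  have 1: "?B x y m = (\<Sum>i\<in>{1..n}. x i * ?B (evec i) y m)"
    by (rule linear_expand[of n "\<lambda>x. ?B x y"])
      (auto simp: linmapD[OF \<phi>] linmapD[OF \<psi>] x y c amult_add_left amult_scale_left)
  have 2: "?B x y m = (\<Sum>j\<in>{1..n}. y j * ?B x (evec j) m)" for x
    by (rule linear_expand[of n "\<lambda>y. ?B x y"])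
      (auto simp: linmapD[OF \<phi>] linmapD[OF \<psi>] x y c amult_add_right amult_scale_right)
  have "?B x y m = (\<Sum>i\<in>{1..n}. \<Sum>j\<in>{1..n}. x i * y j * ?B (evec i) (evec j) m)"
    by (simp only: 1 2[of "evec _"] sum_distrib_left mult.assoc)
  moreover have "?B x y m = 0" "amult n (transport n \<phi> \<psi> c) x y m = 0" if "m \<notin> {1..n}"
    using linmapD(1)[OF \<phi> amult_Vsp[OF c]] amult_Vsp[OF transport_Str] VspD that by blast+
  moreover have "amult n (transport n \<phi> \<psi> c) x y m
      = (\<Sum>i\<in>{1..n}. \<Sum>j\<in>{1..n}. x i * y j * ?B (evec i) (evec j) m)" if "m \<in> {1..n}"
    unfolding amult_def[of n "transport n \<phi> \<psi> c"]
    by (intro sum.cong refl) (use that in \<open>simp add: transport_def\<close>)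
  ultimately show "amult n (transport n \<phi> \<psi> c) x y m = ?B x y m"
    by (cases "m \<in> {1..n}") simp_all
qed

lemma orbitI:
  assumes "c' \<in> Str n" "linmap n \<phi>" "bij_betw \<phi> (Vsp n) (Vsp n)"
    "\<And>x y. x \<in> Vsp n \<Longrightarrow> y \<in> Vsp n \<Longrightarrow> \<phi> (amult n c x y) = amult n c' (\<phi> x) (\<phi> y)"
  shows "c' \<in> orbit n c"
  unfolding orbit_def using assms linmapD[OF assms(2)] by blast

lemma orbitE:
  assumes "c' \<in> orbit n c"
  obtains \<phi> where "c' \<in> Str n" "linmap n \<phi>" "bij_betw \<phi> (Vsp n) (Vsp n)"
    "\<And>x y. x \<in> Vsp n \<Longrightarrow> y \<in> Vsp n \<Longrightarrow> \<phi> (amult n c x y) = amult n c' (\<phi> x) (\<phi> y)"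
proof -
  from assms obtain \<phi> where "c' \<in> Str n" "bij_betw \<phi> (Vsp n) (Vsp n)"
    "\<forall>x\<in>Vsp n. \<forall>y\<in>Vsp n. \<phi> (x + y) = \<phi> x + \<phi> y"
    "\<forall>a. \<forall>x\<in>Vsp n. \<phi> (\<lambda>t. a * x t) = (\<lambda>t. a * \<phi> x t)"
    "\<forall>x\<in>Vsp n. \<forall>y\<in>Vsp n. \<phi> (amult n c x y) = amult n c' (\<phi> x) (\<phi> y)"
    unfolding orbit_def by auto
  then show thesis by (intro that[of \<phi>]) (auto simp: linmap_def dest: bij_betwE)
qed

lemma linmap_inv_into:
  assumes lin: "linmap n \<phi>" and bij: "bij_betw \<phi> (Vsp n) (Vsp n)"
  shows "linmap n (inv_into (Vsp n) \<phi>)"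
proof -
  let ?i = "inv_into (Vsp n) \<phi>"
  have mem: "?i x \<in> Vsp n" if "x \<in> Vsp n" for x
    using bij_betw_inv_into[OF bij] that by (auto dest: bij_betwE)
  have r: "\<phi> (?i x) = x" if "x \<in> Vsp n" for x
    using bij that by (simp add: bij_betw_inv_into_right)
  have l: "?i (\<phi> x) = x" if "x \<in> Vsp n" for x
    using bij that by (simp add: bij_betw_inv_into_left)
  have "?i (x + y) = ?i x + ?i y" if "x \<in> Vsp n" "y \<in> Vsp n" for x y
    using l[of "?i x + ?i y"] that by (simp add: mem r linmapD(2)[OF lin])
  moreover have "?i (\<lambda>t. a * x t) = (\<lambda>t. a * ?i x t)" if "x \<in> Vsp n" for a x
    using l[of "\<lambda>t. a * ?i x t"] that by (simp add: mem r linmapD(3)[OF lin])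
  ultimately show ?thesis using mem by (simp add: linmap_def)
qed

lemma orbit_sym:
  assumes c: "c \<in> Str n" and "c' \<in> orbit n c"
  shows "c \<in> orbit n c'"
proof -
  from assms(2) obtain \<phi> where \<phi>: "c' \<in> Str n" "linmap n \<phi>" "bij_betw \<phi> (Vsp n) (Vsp n)"
    "\<And>x y. x \<in> Vsp n \<Longrightarrow> y \<in> Vsp n \<Longrightarrow> \<phi> (amult n c x y) = amult n c' (\<phi> x) (\<phi> y)"
    by (rule orbitE) blast
  let ?i = "inv_into (Vsp n) \<phi>"
  have li: "linmap n ?i" using \<phi>(2,3) by (rule linmap_inv_into)
  have r: "\<phi> (?i x) = x" if "x \<in> Vsp n" for x
    using \<phi>(3) that by (simp add: bij_betw_inv_into_right)
  have l: "?i (\<phi> x) = x" if "x \<in> Vsp n" for x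
    using \<phi>(3) that by (simp add: bij_betw_inv_into_left)
  show ?thesis
  proof (rule orbitI[OF c li bij_betw_inv_into[OF \<phi>(3)]])
    fix x y assume xy: "x \<in> Vsp n" "y \<in> Vsp n"
    have "\<phi> (amult n c (?i x) (?i y)) = amult n c' x y"
      using \<phi>(4)[of "?i x" "?i y"] xy by (simp add: r linmapD(1)[OF li])
    then show "?i (amult n c' x y) = amult n c (?i x) (?i y)"
      using l[OF amult_Vsp[OF c]] by metis
  qed
qed

lemma orbit_trans:
  assumes "c' \<in> orbit n c" "c'' \<in> orbit n c'"
  shows "c'' \<in> orbit n c"
proof -
  from assms(1) obtain \<phi> where \<phi>: "c' \<in> Str n" "linmap n \<phi>" "bij_betw \<phi> (Vsp n) (Vsp n)"
    "\<And>x y. x \<in> Vsp n \<Longrightarrow> y \<in> Vsp n \<Longrightarrow> \<phi> (amult n c x y) = amult n c' (\<phi> x) (\<phi> y)"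
    by (rule orbitE) blast
  from assms(2) obtain \<psi> where \<psi>: "c'' \<in> Str n" "linmap n \<psi>" "bij_betw \<psi> (Vsp n) (Vsp n)"
    "\<And>x y. x \<in> Vsp n \<Longrightarrow> y \<in> Vsp n \<Longrightarrow> \<psi> (amult n c' x y) = amult n c'' (\<psi> x) (\<psi> y)"
    by (rule orbitE) blast
  show ?thesis
  proof (rule orbitI[OF \<psi>(1) _ bij_betw_trans[OF \<phi>(3) \<psi>(3)]])
    show "linmap n (\<psi> \<circ> \<phi>)"
      using linmapD[OF \<phi>(2)] linmapD[OF \<psi>(2)] by (simp add: linmap_def)
  qed (simp add: \<phi>(4) \<psi>(4) linmapD(1)[OF \<phi>(2)])
qed

lemma transport_orbit:
  assumes c: "c \<in> Str n" and \<phi>: "linmap n \<phi>" and \<psi>: "linmap n \<psi>"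
    and inv: "\<And>x. x \<in> Vsp n \<Longrightarrow> \<psi> (\<phi> x) = x" "\<And>x. x \<in> Vsp n \<Longrightarrow> \<phi> (\<psi> x) = x"
  shows "transport n \<phi> \<psi> c \<in> orbit n c"
proof (rule orbitI[OF transport_Str \<phi>])
  show "bij_betw \<phi> (Vsp n) (Vsp n)"
    by (rule bij_betw_byWitness[where f' = \<psi>]) (auto simp: inv linmapD[OF \<phi>] linmapD[OF \<psi>])
  show "\<phi> (amult n c x y) = amult n (transport n \<phi> \<psi> c) (\<phi> x) (\<phi> y)"
    if "x \<in> Vsp n" "y \<in> Vsp n" for x y
    using that by (simp add: amult_transport[OF \<phi> \<psi> c] linmapD(1)[OF \<phi>] inv)
qed

subsection \<open>Nilpotency\<close>

lemma pw_Vsp: "pw n c k x \<Longrightarrow> c \<in> Str n \<Longrightarrow> x \<in> Vsp n"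
  by (induction rule: pw.induct) auto

lemma pw_ge1: "pw n c k x \<Longrightarrow> k \<ge> 1"
  by (induction rule: pw.induct) auto

text \<open>The witness is a preimage of \<open>y\<close> under the isomorphism. The conclusion
  keeps only what carries the vanishing of a power from \<open>c\<close> to \<open>c'\<close>, so
  that no isomorphism has to be named by its users.\<close>

lemma pw_orbit:
  assumes c: "c \<in> Str n" and "c' \<in> orbit n c" and "pw n c' k y"
  shows "\<exists>x. pw n c k x \<and> (x = 0 \<longrightarrow> y = 0)"
proof -
  from assms(2) obtain \<phi> where \<phi>: "c' \<in> Str n" "linmap n \<phi>" "bij_betw \<phi> (Vsp n) (Vsp n)"
    "\<And>x y. x \<in> Vsp n \<Longrightarrow> y \<in> Vsp n \<Longrightarrow> \<phi> (amult n c x y) = amult n c' (\<phi> x) (\<phi> y)"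
    by (rule orbitE) blast
  from assms(3) have "\<exists>x. pw n c k x \<and> y = \<phi> x"
  proof (induction rule: pw.induct)
    case (base y)
    then obtain x where "x \<in> Vsp n" "y = \<phi> x" using \<phi>(3) by (auto simp: bij_betw_def)
    then show ?case using pw.base by blast
  next
    case (zero k)
    then show ?case using linmap_zero[OF \<phi>(2)] pw.zero by metis
  next
    case (prod i x j y)
    then show ?case using pw.prod \<phi>(4) pw_Vsp[OF _ c] by metis
  next
    case (add k x y)
    then show ?case using pw.add linmapD(2)[OF \<phi>(2)] pw_Vsp[OF _ c] by metis
  next
    case (smult k x a)
    then show ?case using pw.smult linmapD(3)[OF \<phi>(2)] pw_Vsp[OF _ c] by metis
  qed
  then show ?thesis using linmap_zero[OF \<phi>(2)] by auto
qed

lemma NilVar_orbit: "c \<in> NilVar n \<Longrightarrow> c' \<in> orbit n c \<Longrightarrow> c' \<in> NilVar n"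
  unfolding NilVar_def nilpotent_str_def
  using pw_orbit[of c n c'] by (auto simp: orbit_def)

definition Tail :: "nat \<Rightarrow> vec set" where
  "Tail k = {x. \<forall>i<k. x i = 0}"

lemma Tail_mono: "k \<le> l \<Longrightarrow> Tail l \<subseteq> Tail k"
  by (auto simp: Tail_def)

lemma TailD: "x \<in> Tail k \<Longrightarrow> i < k \<Longrightarrow> x i = 0"
  by (simp add: Tail_def)

lemma TailI: "(\<And>i. i < k \<Longrightarrow> x i = 0) \<Longrightarrow> x \<in> Tail k"
  by (simp add: Tail_def)

definition tri :: "nat \<Rightarrow> struct set" where
  "tri n = {c \<in> Str n. \<forall>i j k. k \<le> max i j \<longrightarrow> c (i, j, k) = 0}"

lemma triD: "c \<in> tri n \<Longrightarrow> k \<le> max i j \<Longrightarrow> c (i, j, k) = 0"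
  by (simp add: tri_def)

lemma tri_Str: "c \<in> tri n \<Longrightarrow> c \<in> Str n"
  by (simp add: tri_def)

lemma amult_tri_Tail:
  assumes "c \<in> tri n" "x \<in> Tail a" "y \<in> Tail b"
  shows "amult n c x y \<in> Tail (Suc (max a b))"
proof (rule TailI)
  fix k assume k: "k < Suc (max a b)"
  have "x i * y j * c (i, j, k) = 0" for i j
    using TailD[OF assms(2), of i] TailD[OF assms(3), of j] triD[OF assms(1), of k i j] k
    by (cases "i < a"; cases "j < b") auto
  then show "amult n c x y k = 0" by (simp only: amult_def sum.neutral_const)
qed

text \<open>If i + j is at least \<open>2 ^ Suc b\<close>, one of i and j is at least
  \<open>2 ^ b\<close>; that factor lies in \<open>Tail (Suc b)\<close>, and a single
  multiplication, by anything in \<open>Tail 1\<close>, moves it one step down the flag.\<close>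

lemma pw_tri:
  assumes c: "c \<in> tri n" and "pw n c m x"
  shows "2 ^ a \<le> m \<Longrightarrow> x \<in> Tail (Suc a)"
  using assms(2)
proof (induction arbitrary: a rule: pw.induct)
  case (base x)
  then have "2 ^ a \<le> (2::nat) ^ 0" by simp
  then have "a = 0" by (metis bot_nat_0.extremum_uniqueI one_less_numeral_iff power_increasing_iff semiring_norm(76))
  then show ?case using base VspD[of x n 0] by (auto simp: Tail_def)
next
  case (zero k)
  then show ?case by (simp add: Tail_def)
next
  case (prod i x j y)
  have ge: "i \<ge> 1" "j \<ge> 1" using prod.hyps pw_ge1 by auto
  have T1: "x \<in> Tail (Suc 0)" "y \<in> Tail (Suc 0)" using prod.IH[of 0] ge by auto
  show ?case
  proof (cases a)
    case 0
    have "Tail (Suc (max (Suc 0) (Suc 0))) \<subseteq> Tail (Suc a)" using 0 by (intro Tail_mono) auto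
    then show ?thesis using amult_tri_Tail[OF c T1] by blast
  next
    case (Suc b)
    then have "2 ^ b \<le> i \<or> 2 ^ b \<le> j" using prod.prems by auto
    then show ?thesis
    proof
      assume "2 ^ b \<le> i"
      then have "x \<in> Tail (Suc b)" using prod.IH(1) by blast
      then have "amult n c x y \<in> Tail (Suc (max (Suc b) (Suc 0)))"
        using amult_tri_Tail[OF c] T1 by blast
      then show ?thesis using Suc by simp
    next
      assume "2 ^ b \<le> j"
      then have "y \<in> Tail (Suc b)" using prod.IH(2) by blast
      then have "amult n c x y \<in> Tail (Suc (max (Suc 0) (Suc b)))"
        using amult_tri_Tail[OF c] T1 by blast
      then show ?thesis using Suc by simp
    qed
  qed
next
  case (add k x y)
  then show ?case by (simp add: Tail_def)
next
  case (smult k x a')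
  then show ?case by (simp add: Tail_def)
qed

lemma tri_nil_bound:
  assumes "c \<in> tri n" "pw n c (2 ^ n) x"
  shows "x = 0"
proof
  fix i
  have "x \<in> Tail (Suc n)" using pw_tri[OF assms] by simp
  moreover have "x \<in> Vsp n" using pw_Vsp[OF assms(2)] tri_Str[OF assms(1)] .
  ultimately show "x i = 0 i" by (cases "i \<le> n") (auto simp: Tail_def Vsp_def)
qed

lemma tri_NilVar: "c \<in> tri n \<Longrightarrow> c \<in> NilVar n"
  unfolding NilVar_def nilpotent_str_def
  using tri_nil_bound[of c n] tri_Str by (auto intro!: exI[of _ "2 ^ n"])

subsection \<open>Transvections\<close>

definition transvec :: "nat \<Rightarrow> vec \<Rightarrow> vec \<Rightarrow> vec" where
  "transvec k v x = (\<lambda>i. x i + x k * v i)"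

text \<open>When \<open>v k = 0\<close>, the transvection by \<open>- v\<close> is the inverse, so
  the action needs no matrix inversion and is polynomial in \<open>v\<close> and in
  \<open>c\<close>.\<close>

definition tact :: "nat \<Rightarrow> nat \<Rightarrow> vec \<Rightarrow> struct \<Rightarrow> struct" where
  "tact n k v c = transport n (transvec k v) (transvec k (\<lambda>i. - v i)) c"

lemma linmap_transvec [simp]: "v \<in> Vsp n \<Longrightarrow> linmap n (transvec k v)"
  by (auto simp: linmap_def transvec_def Vsp_def fun_eq_iff algebra_simps)

lemma uminus_Vsp [simp]: "v \<in> Vsp n \<Longrightarrow> (\<lambda>i. - v i) \<in> Vsp n"
  by (simp add: Vsp_def)

lemma transvec_inverse [simp]:
  "v k = 0 \<Longrightarrow> transvec k v (transvec k (\<lambda>i. - v i) x) = x"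
  "v k = 0 \<Longrightarrow> transvec k (\<lambda>i. - v i) (transvec k v x) = x"
  by (auto simp: transvec_def)

lemma transvec_Tail [simp]: "x \<in> Tail a \<Longrightarrow> k < a \<Longrightarrow> transvec k v x = x"
  by (auto simp: transvec_def Tail_def)

lemma transvec_evec: "transvec k v (evec j) = (if j = k then evec k + v else evec j)"
  by (auto simp: transvec_def fun_eq_iff evec_apply)

lemma tact_Str [simp]: "tact n k v c \<in> Str n"
  by (simp add: tact_def)

lemma amult_tact:
  assumes "v \<in> Vsp n" "c \<in> Str n" "x \<in> Vsp n" "y \<in> Vsp n"
  shows "amult n (tact n k v c) x y =
    transvec k v (amult n c (transvec k (\<lambda>i. - v i) x) (transvec k (\<lambda>i. - v i) y))"
  unfolding tact_def by (rule amult_transport) (use assms in auto)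

lemma tact_orbit: "v \<in> Vsp n \<Longrightarrow> v k = 0 \<Longrightarrow> c \<in> Str n \<Longrightarrow> tact n k v c \<in> orbit n c"
  unfolding tact_def by (rule transport_orbit) auto

lemma Str_eqI:
  assumes "c \<in> Str n" "c' \<in> Str n"
    "\<And>i j. i \<in> {1..n} \<Longrightarrow> j \<in> {1..n} \<Longrightarrow> amult n c (evec i) (evec j) = amult n c' (evec i) (evec j)"
  shows "c = c'"
proof
  fix v :: "nat \<times> nat \<times> nat"
  obtain i j k where v: "v = (i, j, k)" by (cases v)
  show "c v = c' v"
  proof (cases "i \<in> {1..n} \<and> j \<in> {1..n}")
    case True
    then show ?thesis using assms(3)[of i j] by (simp add: amult_evec v fun_eq_iff)
  next
    case False
    then show ?thesis using StrD[OF assms(1), of i j k] StrD[OF assms(2), of i j k] v by auto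
  qed
qed

lemma tact_tact_inverse:
  assumes "v \<in> Vsp n" "v k = 0" "c \<in> Str n"
  shows "tact n k v (tact n k (\<lambda>i. - v i) c) = c"
proof (rule Str_eqI[of _ n])
  fix i j assume ij: "i \<in> {1..n}" "j \<in> {1..n}"
  have V: "transvec k (\<lambda>i. - v i) (evec j) \<in> Vsp n" if "j \<in> {1..n}" for j
    using linmapD(1)[OF linmap_transvec] that assms by simp
  show "amult n (tact n k v (tact n k (\<lambda>i. - v i) c)) (evec i) (evec j) = amult n c (evec i) (evec j)"
    using ij assms V[of i] V[of j]
    by (simp add: amult_tact)
qed (use assms in auto)

lemma zero_const_Vsp [simp]: "(\<lambda>i. 0) \<in> Vsp n"
  by (simp add: Vsp_def)

lemma tact_zero: "c \<in> Str n \<Longrightarrow> tact n k (\<lambda>i. 0) c = c"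
  using amult_tact[of "\<lambda>i. 0" n c] by (intro Str_eqI[of _ n]) (auto simp: transvec_def)

subsection \<open>Polynomial functions\<close>

lemma polyfun_sum: "(\<And>i. i \<in> A \<Longrightarrow> f i \<in> polyfun) \<Longrightarrow> (\<lambda>s. \<Sum>i\<in>A. f i s) \<in> polyfun"
  by (induction A rule: infinite_finite_induct) (auto intro: polyfun.intros)

lemma polyfun_prod: "(\<And>i. i \<in> A \<Longrightarrow> f i \<in> polyfun) \<Longrightarrow> (\<lambda>s. \<Prod>i\<in>A. f i s) \<in> polyfun"
  by (induction A rule: infinite_finite_induct) (auto intro: polyfun.intros)

lemma polyfun_uminus: "f \<in> polyfun \<Longrightarrow> (\<lambda>s. - f s) \<in> polyfun"
  using pmult[OF pconst[of "-1"], of f] by simp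

lemma polyfun_diff: "f \<in> polyfun \<Longrightarrow> g \<in> polyfun \<Longrightarrow> (\<lambda>s. f s - g s) \<in> polyfun"
  using padd[of f, OF _ polyfun_uminus[of g]] by simp

definition polymap :: "(struct \<Rightarrow> 'b \<Rightarrow> complex) \<Rightarrow> bool" where
  "polymap X \<longleftrightarrow> (\<forall>t. (\<lambda>s. X s t) \<in> polyfun)"

lemma polymapD: "polymap X \<Longrightarrow> (\<lambda>s. X s t) \<in> polyfun"
  by (simp add: polymap_def)

lemma polymap_const: "polymap (\<lambda>s. x)"
  by (simp add: polymap_def pconst)

lemma polymap_id: "polymap (\<lambda>s. s)"
  by (simp add: polymap_def pvar)

lemma polymap_add: "polymap X \<Longrightarrow> polymap Y \<Longrightarrow> polymap (\<lambda>s. X s + Y s)"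
  by (simp add: polymap_def padd)

lemma polymap_scale: "polymap X \<Longrightarrow> polymap (\<lambda>s t. a * X s t)"
  by (simp add: polymap_def pmult pconst)

lemma polyfun_comp:
  assumes "p \<in> polyfun" "polymap C"
  shows "(\<lambda>s. p (C s)) \<in> polyfun"
  using assms(1) by induction (auto intro: polyfun.intros polymapD[OF assms(2)])

lemma polymap_amult:
  "polymap C \<Longrightarrow> polymap X \<Longrightarrow> polymap Y \<Longrightarrow> polymap (\<lambda>s. amult n (C s) (X s) (Y s))"
  unfolding polymap_def amult_def by (intro allI polyfun_sum pmult) auto

lemma polymap_transvec:
  "polymap v \<Longrightarrow> polymap X \<Longrightarrow> polymap (\<lambda>s. transvec k (v s) (X s))"
  unfolding polymap_def transvec_def by (intro allI padd pmult) auto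

lemma polymap_tact:
  assumes "polymap v" "polymap C"
  shows "polymap (\<lambda>s. tact n k (v s) (C s))"
proof -
  have m: "polymap (\<lambda>s i. - v s i)"
    using assms(1) by (simp add: polymap_def polyfun_uminus)
  have "polymap (\<lambda>s. transvec k (v s) (amult n (C s)
      (transvec k (\<lambda>i. - v s i) (evec i)) (transvec k (\<lambda>i. - v s i) (evec j))))" for i j
    by (intro polymap_transvec polymap_amult polymap_const assms m)
  from polymapD[OF this] have "(\<lambda>s. tact n k (v s) (C s) (i, j, l)) \<in> polyfun" for i j l
    by (cases "i \<in> {1..n} \<and> j \<in> {1..n} \<and> l \<in> {1..n}")
      (simp_all only: tact_def transport_def prod.case if_True if_False pconst simp_thms)
  then show ?thesis by (auto simp: polymap_def)
qed

lemma polyfun_line: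
  assumes "p \<in> polyfun"
  shows "\<exists>P. \<forall>z. p (\<lambda>v. a v + z * b v) = poly P z"
  using assms
proof induction
  case (pconst x)
  then show ?case by (intro exI[of _ "[:x:]"]) simp
next
  case (pvar v)
  then show ?case by (intro exI[of _ "[:a v, b v:]"]) simp
next
  case (padd p q)
  then show ?case by (metis poly_add)
next
  case (pmult p q)
  then show ?case by (metis poly_mult)
qed

text \<open>The algebraic substitute for letting z tend to 0: on the line the polynomial has one
  variable and infinitely many roots.\<close>

lemma polyfun_line_zero:
  assumes "p \<in> polyfun" "\<And>z. z \<noteq> 0 \<Longrightarrow> p (\<lambda>v. a v + z * b v) = 0"
  shows "p a = 0"
proof -
  obtain P where P: "\<And>z. p (\<lambda>v. a v + z * b v) = poly P z"
    using polyfun_line[OF assms(1)] by blast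
  have "UNIV - {0} \<subseteq> {z. poly P z = 0}" using assms(2) P by auto
  moreover have "infinite (UNIV - {0 :: complex})" by (simp add: infinite_UNIV_char_0)
  ultimately have "P = 0" using poly_roots_finite finite_subset by blast
  then show ?thesis using P[of 0] by simp
qed

definition coordsp :: "(nat \<times> nat \<times> nat) set \<Rightarrow> struct set" where
  "coordsp S = {s. \<forall>v. v \<notin> S \<longrightarrow> s v = 0}"

text \<open>Join \<open>s\<close> and \<open>s'\<close> by a line inside the coordinate space. Both
  restrictions are nonzero polynomials in one variable, hence so is their product.\<close>

lemma polyfun_coordsp_domain:
  assumes p: "p \<in> polyfun" "s \<in> coordsp S" "p s \<noteq> 0"
    and q: "q \<in> polyfun" "s' \<in> coordsp S" "q s' \<noteq> 0"
  shows "\<exists>s''\<in>coordsp S. p s'' \<noteq> 0 \<and> q s'' \<noteq> 0"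
proof -
  define L where "L z = (\<lambda>v. s v + z * (s' v - s v))" for z :: complex
  obtain P where P: "\<And>z. p (L z) = poly P z" unfolding L_def using polyfun_line[OF p(1), of s "\<lambda>v. s' v - s v"] by blast
  obtain Q where Q: "\<And>z. q (L z) = poly Q z" unfolding L_def using polyfun_line[OF q(1), of s "\<lambda>v. s' v - s v"] by blast
  have "L 0 = s" "L 1 = s'" by (auto simp: L_def)
  then have "P \<noteq> 0" "Q \<noteq> 0" using P[of 0] Q[of 1] p(3) q(3) by auto
  then have "P * Q \<noteq> 0" by simp
  then obtain z where "poly (P * Q) z \<noteq> 0" using poly_all_0_iff_0 by blast
  moreover have "L z \<in> coordsp S" using p(2) q(2) by (simp add: coordsp_def L_def)
  ultimately show ?thesis using P Q by (intro bexI[of _ "L z"]) auto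
qed

subsection \<open>Zariski closure\<close>

lemma zclosure_eq:
  assumes "S \<subseteq> Str n"
  shows "zclosure n S = {c \<in> Str n. \<forall>p\<in>polyfun. (\<forall>s\<in>S. p s = 0) \<longrightarrow> p c = 0}" (is "_ = ?R")
proof
  have "?R = {c \<in> Str n. \<forall>p\<in>{p\<in>polyfun. \<forall>s\<in>S. p s = 0}. p c = 0}" by blast
  then have "zclosed n ?R" unfolding zclosed_def by blast
  moreover have "S \<subseteq> ?R" using assms by auto
  ultimately show "zclosure n S \<subseteq> ?R" unfolding zclosure_def by blast
next
  show "?R \<subseteq> zclosure n S" unfolding zclosure_def zclosed_def by blast
qed

lemma zclosed_zclosure: "S \<subseteq> Str n \<Longrightarrow> zclosed n (zclosure n S)"
  unfolding zclosed_def zclosure_eq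
  by (intro exI[of _ "{p \<in> polyfun. \<forall>s\<in>S. p s = 0}"]) blast

lemma zclosure_minimal: "zclosed n Z \<Longrightarrow> S \<subseteq> Z \<Longrightarrow> zclosure n S \<subseteq> Z"
  by (auto simp: zclosure_def)

lemma zclosure_superset: "S \<subseteq> zclosure n S"
  by (auto simp: zclosure_def)

lemma zclosed_separate:
  assumes "zclosed n Z" "x \<in> Str n" "x \<notin> Z"
  obtains p where "p \<in> polyfun" "\<And>z. z \<in> Z \<Longrightarrow> p z = 0" "p x \<noteq> 0"
  using assms unfolding zclosed_def by blast

text \<open>A closed set that misses a point of the image yields a polynomial whose pullback to the
  affine space is not identically zero; two such pullbacks are nonzero at a common point.\<close>

lemma zirreducible_image:
  assumes F: "polymap F" "\<And>s. F s \<in> Str n"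
  shows "zirreducible n (zclosure n (F ` coordsp S))" (is "zirreducible n ?X")
  unfolding zirreducible_def
proof (intro conjI allI impI)
  have Str: "F ` coordsp S \<subseteq> Str n" using F by auto
  have "(\<lambda>_. 0) \<in> coordsp S" by (simp add: coordsp_def)
  then show "?X \<noteq> {}" using zclosure_superset[of "F ` coordsp S" n] by auto
  fix Z1 Z2 assume Z: "zclosed n Z1 \<and> zclosed n Z2 \<and> ?X \<subseteq> Z1 \<union> Z2"
  have *: "\<exists>p\<in>polyfun. (\<forall>z\<in>Z. p z = 0) \<and> (\<exists>s\<in>coordsp S. p (F s) \<noteq> 0)"
    if Z: "zclosed n Z" "\<not> ?X \<subseteq> Z" for Z
  proof -
    obtain s where s: "s \<in> coordsp S" "F s \<notin> Z" using zclosure_minimal[OF Z(1)] Z(2) by blast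
    then show ?thesis using zclosed_separate[OF Z(1) F(2) s(2)] by metis
  qed
  show "?X \<subseteq> Z1 \<or> ?X \<subseteq> Z2"
  proof (rule ccontr)
    assume "\<not> (?X \<subseteq> Z1 \<or> ?X \<subseteq> Z2)"
    then obtain p q s s' where "p \<in> polyfun" "\<forall>z\<in>Z1. p z = 0" "s \<in> coordsp S" "p (F s) \<noteq> 0"
      "q \<in> polyfun" "\<forall>z\<in>Z2. q z = 0" "s' \<in> coordsp S" "q (F s') \<noteq> 0"
      using *[of Z1] *[of Z2] Z by blast
    then obtain s'' where "s'' \<in> coordsp S" "p (F s'') \<noteq> 0" "q (F s'') \<noteq> 0"
      using polyfun_coordsp_domain[OF polyfun_comp[OF _ F(1)] _ _ polyfun_comp[OF _ F(1)]] by metis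
    then show False
      using Z zclosure_superset[of "F ` coordsp S" n] \<open>\<forall>z\<in>Z1. p z = 0\<close> \<open>\<forall>z\<in>Z2. q z = 0\<close> by blast
  qed
qed

subsection \<open>Triangularizing a nilpotent structure\<close>

definition Tpos :: "nat \<Rightarrow> (nat \<times> nat \<times> nat) set" where
  "Tpos n = {(i, j, k). 1 \<le> i \<and> 1 \<le> j \<and> max i j < k \<and> k \<le> n}"

definition Upos :: "nat \<Rightarrow> (nat \<times> nat \<times> nat) set" where
  "Upos n = {(i, j, k). 1 \<le> i \<and> i < j \<and> j \<le> n \<and> k = 0}"

definition trunc :: "nat \<Rightarrow> struct \<Rightarrow> struct" where
  "trunc n s = (\<lambda>v. if v \<in> Tpos n then s v else 0)"

text \<open>The transvection for column j is applied after those for smaller columns, which fix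
  \<open>evec j\<close>, and later ones fix \<open>evec j + col j s\<close>. So the product of all
  of them is the matrix with exactly these columns.\<close>

definition col :: "nat \<Rightarrow> struct \<Rightarrow> vec" where
  "col j s = (\<lambda>i. if 1 \<le> i \<and> i < j then s (i, j, 0) else 0)"

text \<open>Points of the source are structures again: the entries at \<^term>\<open>Tpos n\<close> are the structure
  constants of a triangular algebra, and the entries \<open>(i, j, 0)\<close> with \<open>i < j\<close>, which are
  never structure constants, are the coordinates of an upper unitriangular matrix.\<close>

fun Phi :: "nat \<Rightarrow> nat \<Rightarrow> struct \<Rightarrow> struct" where
  "Phi n 0 s = trunc n s"
| "Phi n (Suc k) s = tact n (Suc k) (col (Suc k) s) (Phi n k s)"

lemma trunc_tri: "trunc n s \<in> tri n"
  by (auto simp: tri_def trunc_def Tpos_def intro!: StrI)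

lemma trunc_id: "c \<in> tri n \<Longrightarrow> trunc n c = c"
  unfolding trunc_def Tpos_def
  using triD[of c n] StrD[OF tri_Str, of c n] by (intro ext) (force simp: not_less not_le)

lemma col_Vsp [simp]: "k \<le> n \<Longrightarrow> col k s \<in> Vsp n"
  by (auto simp: col_def Vsp_def)

lemma col_self [simp]: "col k s k = 0"
  by (simp add: col_def)

lemma Phi_Str [simp]: "Phi n k s \<in> Str n"
  using trunc_tri[of n s] tri_Str by (cases k) auto

lemma Phi_orbit: "k \<le> n \<Longrightarrow> Phi n k s \<in> orbit n (trunc n s)"
proof (induction k)
  case 0
  have "trunc n s \<in> Str n" using trunc_tri tri_Str by blast
  then show ?case by (auto intro!: orbitI[of _ n "\<lambda>x. x"] simp: linmap_def bij_betw_def)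
next
  case (Suc k)
  then show ?case using tact_orbit[of "col (Suc k) s" n "Suc k" "Phi n k s"] orbit_trans by auto
qed

lemma Phi_NilVar: "k \<le> n \<Longrightarrow> Phi n k s \<in> NilVar n"
  using NilVar_orbit[OF tri_NilVar[OF trunc_tri] Phi_orbit] .

lemma polymap_Phi: "polymap (Phi n k)"
proof (induction k)
  case 0
  have "(\<lambda>s. trunc n s t) \<in> polyfun" for t
    by (cases "t \<in> Tpos n") (simp_all add: trunc_def pvar pconst)
  then show ?case by (simp add: polymap_def)
next
  case (Suc k)
  have "(\<lambda>s. col (Suc k) s i) \<in> polyfun" for i
    by (cases "1 \<le> i \<and> i < Suc k") (auto simp: col_def pvar intro: pconst)
  then have "polymap (col (Suc k))" by (simp add: polymap_def)
  then show ?case using polymap_tact[OF _ Suc] by simp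
qed

lemma Phi_cong:
  assumes "\<And>v. v \<in> Tpos n \<Longrightarrow> s v = s' v"
    and "\<And>i j. 1 \<le> i \<Longrightarrow> i < j \<Longrightarrow> j \<le> k \<Longrightarrow> s (i, j, 0) = s' (i, j, 0)"
  shows "Phi n k s = Phi n k s'"
  using assms(2)
proof (induction k)
  case 0
  then show ?case using assms(1) by (auto simp: trunc_def)
next
  case (Suc k)
  have "col (Suc k) s = col (Suc k) s'" using Suc.prems by (auto simp: col_def)
  then show ?case using Suc by simp
qed

text \<open>The invariant of the triangularization: it is vacuous at \<open>k = n\<close>, amounts
  to triangularity at \<open>k = 0\<close>, and k decreases by one per transvection.\<close>

definition tri_above :: "nat \<Rightarrow> nat \<Rightarrow> struct \<Rightarrow> bool" where
  "tri_above n k c \<longleftrightarrow> (\<forall>j\<in>{1..n}. k < j \<longrightarrow> (\<forall>z\<in>Vsp n.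
     amult n c z (evec j) \<in> Tail (Suc j) \<and> amult n c (evec j) z \<in> Tail (Suc j)))"

lemma tri_above_0:
  assumes "tri_above n 0 c" "c \<in> Str n"
  shows "c \<in> tri n"
proof -
  have "c (i, j, k) = 0" if "k \<le> max i j" for i j k
  proof (cases "i \<in> {1..n} \<and> j \<in> {1..n}")
    case True
    then have "amult n c (evec i) (evec j) \<in> Tail (Suc i) \<inter> Tail (Suc j)"
      using assms(1) unfolding tri_above_def by auto
    then have "(\<lambda>k. c (i, j, k)) \<in> Tail (Suc i) \<inter> Tail (Suc j)" using True amult_evec by simp
    then show ?thesis using that by (auto simp: Tail_def max_def split: if_splits)
  qed (use StrD[OF assms(2)] in blast)
  then show ?thesis using assms(2) by (simp add: tri_def)
qed

lemma Tail_closed: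
  "x \<in> Tail k \<Longrightarrow> y \<in> Tail k \<Longrightarrow> x + y \<in> Tail k"
  "x \<in> Tail k \<Longrightarrow> (\<lambda>t. a * x t) \<in> Tail k"
  by (auto simp: Tail_def)

lemma tri_above_Tail:
  assumes "tri_above n k c" "y \<in> Tail j" "y \<in> Vsp n" "k < j" "z \<in> Vsp n"
  shows "amult n c z y \<in> Tail (Suc j)" "amult n c y z \<in> Tail (Suc j)"
proof -
  have *: "amult n c z (evec i) \<in> Tail (Suc j)" "amult n c (evec i) z \<in> Tail (Suc j)"
    if "i \<in> {1..n}" "j \<le> i" for i
    using assms(1,4,5) that Tail_mono[of "Suc j" "Suc i"] unfolding tri_above_def
    by (meson Suc_le_mono less_le_trans subsetD)+
  have "amult n c z y m = (\<Sum>i\<in>{1..n}. y i * amult n c z (evec i) m)" for m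
    by (rule linear_expand[OF amult_add_right amult_scale_right assms(3)])
  moreover have "amult n c y z m = (\<Sum>i\<in>{1..n}. y i * amult n c (evec i) z m)" for m
    by (rule linear_expand[of n "\<lambda>y. amult n c y z", OF amult_add_left amult_scale_left assms(3)])
  moreover have "y i * amult n c z (evec i) m = 0" "y i * amult n c (evec i) z m = 0"
    if "m < Suc j" "i \<in> {1..n}" for i m
    using *[of i] that TailD[OF assms(2), of i] by (cases "i < j"; auto simp: Tail_def)+
  ultimately show "amult n c z y \<in> Tail (Suc j)" "amult n c y z \<in> Tail (Suc j)"
    by (auto intro!: TailI sum.neutral)
qed

text \<open>For j > k the transvection at \<open>l \<le> k\<close> fixes both \<open>evec j\<close>
  and all of \<open>Tail (Suc j)\<close>, so only the other factor \<open>z\<close> changes, and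
  that one is arbitrary.\<close>

lemma tri_above_tact:
  assumes "tri_above n k c" "l \<le> k" "v \<in> Vsp n" "c \<in> Str n"
  shows "tri_above n k (tact n l v c)"
  unfolding tri_above_def
proof (intro ballI impI)
  fix j z assume j: "j \<in> {1..n}" "k < j" and z: "z \<in> Vsp n"
  let ?z = "transvec l (\<lambda>i. - v i) z"
  have z': "?z \<in> Vsp n" using linmapD(1)[OF linmap_transvec] z assms(3) by simp
  have e: "transvec l (\<lambda>i. - v i) (evec j) = evec j" using j assms(2) by (simp add: transvec_evec)
  have "amult n c ?z (evec j) \<in> Tail (Suc j)" "amult n c (evec j) ?z \<in> Tail (Suc j)"
    using assms(1) j z' unfolding tri_above_def by auto
  then show "amult n (tact n l v c) z (evec j) \<in> Tail (Suc j) \<and>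
      amult n (tact n l v c) (evec j) z \<in> Tail (Suc j)"
    using j z assms by (simp add: amult_tact e)
qed

text \<open>The last power of the algebra not contained in \<open>Tail (Suc k)\<close> provides the next vector of an
  adapted flag.\<close>

lemma nilpotent_flag_step:
  assumes c: "c \<in> NilVar n" and k: "k \<in> {1..n}"
  obtains b where "b \<in> Vsp n" "b \<notin> Tail (Suc k)"
    "\<And>z. z \<in> Vsp n \<Longrightarrow> amult n c z b \<in> Tail (Suc k) \<and> amult n c b z \<in> Tail (Suc k)"
proof -
  define Q where "Q m \<longleftrightarrow> m \<ge> 1 \<and> (\<forall>x. pw n c m x \<longrightarrow> x \<in> Tail (Suc k))" for m
  obtain K where K: "K \<ge> 1" "\<forall>x. pw n c K x \<longrightarrow> x = 0"
    using c unfolding NilVar_def nilpotent_str_def by blast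
  then have "Q K" by (auto simp: Q_def Tail_def)
  moreover have "\<not> Q 0" by (simp add: Q_def)
  ultimately obtain m where m: "\<not> Q m" "Q (Suc m)"
    using dec_induct[of 0 K "\<lambda>m. \<not> Q m"] by blast
  have "evec k \<notin> Tail (Suc k)" by (simp add: Tail_def evec_apply)
  then have "\<not> Q 1" using pw.base[OF evec_Vsp[OF k]] by (auto simp: Q_def)
  then have "m \<ge> 1" using m by (cases m) auto
  then obtain b where b: "pw n c m b" "b \<notin> Tail (Suc k)" using m(1) by (auto simp: Q_def)
  show thesis
  proof (rule that[of b])
    show "b \<in> Vsp n" using pw_Vsp[OF b(1)] c by (simp add: NilVar_def)
    fix z assume "z \<in> Vsp n"
    then have "pw n c 1 z" by (rule pw.base)
    then have "pw n c (Suc m) (amult n c z b)" "pw n c (Suc m) (amult n c b z)"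
      using pw.prod[of n c 1 z m b] pw.prod[of n c m b 1 z] b(1) by simp_all
    then show "amult n c z b \<in> Tail (Suc k) \<and> amult n c b z \<in> Tail (Suc k)"
      using m(2) by (simp add: Q_def)
  qed (rule b(2))
qed

text \<open>Scaled to pivot 1, \<open>b\<close> agrees with \<open>evec k + w\<close> modulo
  \<open>Tail (Suc k)\<close>. The transvection makes \<open>evec k + w\<close> the new k-th basis
  vector, which inherits the absorption property of \<open>b\<close>; the discrepancy
  \<open>r\<close> is covered by the positions above k.\<close>

lemma tri_above_eliminate:
  assumes c: "tri_above n k c" "c \<in> Str n" "k \<in> {1..n}"
    and b: "b \<in> Vsp n" "b k \<noteq> 0"
      "\<And>z. z \<in> Vsp n \<Longrightarrow> amult n c z b \<in> Tail (Suc k) \<and> amult n c b z \<in> Tail (Suc k)"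
  defines "w \<equiv> \<lambda>i. if i < k then b i / b k else 0"
  shows "tri_above n (k - 1) (tact n k (\<lambda>i. - w i) c)"
  unfolding tri_above_def
proof (intro ballI impI)
  have w: "w \<in> Vsp n" "w k = 0" using b(1) c(3) by (auto simp: w_def Vsp_def)
  fix j z assume j: "j \<in> {1..n}" "k - 1 < j" and z: "z \<in> Vsp n"
  let ?c = "tact n k (\<lambda>i. - w i) c"
  show "amult n ?c z (evec j) \<in> Tail (Suc j) \<and> amult n ?c (evec j) z \<in> Tail (Suc j)"
  proof (cases "j = k")
    case False
    then have "k < j" using j by auto
    moreover have "tri_above n k ?c" by (rule tri_above_tact) (use c w in auto)
    ultimately show ?thesis using j z unfolding tri_above_def by blast
  next
    case True
    let ?z = "transvec k w z"
    have z': "?z \<in> Vsp n" using linmapD(1)[OF linmap_transvec] z w by simp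
    define r where "r = (\<lambda>i. if i > k then - b i / b k else 0)"
    have r: "r \<in> Vsp n" "r \<in> Tail (Suc k)" using b(1) by (auto simp: r_def Vsp_def Tail_def)
    have e: "transvec k w (evec k) = (\<lambda>i. (1 / b k) * b i) + r"
      using b(2) by (auto simp: transvec_evec fun_eq_iff evec_apply r_def w_def field_simps)
    have 1: "amult n c ?z b \<in> Tail (Suc k)" "amult n c b ?z \<in> Tail (Suc k)"
      using b(3)[OF z'] by auto
    have 2: "amult n c ?z r \<in> Tail (Suc k)" "amult n c r ?z \<in> Tail (Suc k)"
      using tri_above_Tail[OF c(1) r(2,1) _ z'] Tail_mono[of "Suc k" "Suc (Suc k)"] by auto
    have "amult n c ?z ((\<lambda>i. (1 / b k) * b i) + r) \<in> Tail (Suc k)"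
      unfolding amult_add_right amult_scale_right by (rule Tail_closed(1)[OF Tail_closed(2)[OF 1(1)] 2(1)])
    moreover have "amult n c ((\<lambda>i. (1 / b k) * b i) + r) ?z \<in> Tail (Suc k)"
      unfolding amult_add_left amult_scale_left by (rule Tail_closed(1)[OF Tail_closed(2)[OF 1(2)] 2(2)])
    ultimately have "amult n c ?z (transvec k w (evec k)) \<in> Tail (Suc k)"
        "amult n c (transvec k w (evec k)) ?z \<in> Tail (Suc k)"
      by (simp_all add: e)
    moreover have "transvec k (\<lambda>i. - (- w i)) = transvec k w" by simp
    ultimately show ?thesis
      using True j z w c amult_tact[of "\<lambda>i. - w i" n c] by simp
  qed
qed

text \<open>If the new flag vector has no component on \<open>e_k\<close>, an arbitrarily small transvection creates
  one; this is why the third rule only asks for \<open>\<epsilon> \<noteq> 0\<close>.\<close>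

lemma nilpotent_triangularize:
  assumes base: "\<And>c. c \<in> tri n \<Longrightarrow> Q 0 c"
    and elim: "\<And>k v c. Suc k \<le> n \<Longrightarrow> c \<in> NilVar n \<Longrightarrow> v \<in> Vsp n \<Longrightarrow> (\<And>i. i \<ge> Suc k \<Longrightarrow> v i = 0)
        \<Longrightarrow> Q k (tact n (Suc k) (\<lambda>i. - v i) c) \<Longrightarrow> Q (Suc k) c"
    and perturb: "\<And>k l c. Suc k \<le> n \<Longrightarrow> l \<le> k \<Longrightarrow> c \<in> NilVar n
        \<Longrightarrow> (\<And>\<epsilon>. \<epsilon> \<noteq> 0 \<Longrightarrow> Q (Suc k) (tact n l (\<lambda>i. \<epsilon> * evec (Suc k) i) c)) \<Longrightarrow> Q (Suc k) c"
    and c: "c \<in> NilVar n"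
  shows "Q n c"
proof -
  \<comment> \<open>The index of \<open>Q\<close> counts the columns that remain to be
    treated.\<close>
  have "Q k c" if "c \<in> NilVar n" "tri_above n k c" "k \<le> n" for k c
    using that
  proof (induction k arbitrary: c)
    case 0
    then show ?case using tri_above_0 base by (auto simp: NilVar_def)
  next
    case (Suc k)
    let ?K = "Suc k"
    have K: "?K \<in> {1..n}" using Suc.prems by auto
    have *: "Q ?K c" if c: "c \<in> NilVar n" "tri_above n ?K c" and b: "b \<in> Vsp n" "b ?K \<noteq> 0"
      "\<And>z. z \<in> Vsp n \<Longrightarrow> amult n c z b \<in> Tail (Suc ?K) \<and> amult n c b z \<in> Tail (Suc ?K)" for b c
    proof -
      define w where "w = (\<lambda>i. if i < ?K then b i / b ?K else 0)"
      have cS: "c \<in> Str n" using c by (simp add: NilVar_def)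
      have w: "w \<in> Vsp n" "w ?K = 0" using b(1) K by (auto simp: w_def Vsp_def)
      have "tri_above n k (tact n ?K (\<lambda>i. - w i) c)"
        using tri_above_eliminate[OF c(2) cS K b] by (simp add: w_def)
      moreover have "tact n ?K (\<lambda>i. - w i) c \<in> NilVar n"
        using NilVar_orbit[OF c(1) tact_orbit] w cS by auto
      ultimately have "Q k (tact n ?K (\<lambda>i. - w i) c)" using Suc by auto
      then show ?thesis using elim[of k c w] c w(1) Suc.prems(3) by (auto simp: w_def)
    qed
    have cS: "c \<in> Str n" using Suc.prems by (simp add: NilVar_def)
    obtain b where b: "b \<in> Vsp n" "b \<notin> Tail (Suc ?K)"
      "\<And>z. z \<in> Vsp n \<Longrightarrow> amult n c z b \<in> Tail (Suc ?K) \<and> amult n c b z \<in> Tail (Suc ?K)"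
      using nilpotent_flag_step[OF Suc.prems(1) K] by blast
    show ?case
    proof (cases "b ?K = 0")
      case False
      then show ?thesis using *[OF Suc.prems(1,2)] b by blast
    next
      case True
      \<comment> \<open>As \<open>b\<close> is outside \<open>Tail (Suc ?K)\<close> but has no entry
        at \<open>?K\<close>, it has one further up, from which the perturbation feeds position
        \<open>?K\<close>.\<close>
      then obtain l where l: "l \<le> k" "b l \<noteq> 0"
        using b(2) unfolding Tail_def by (auto simp: less_Suc_eq intro: less_imp_le)
      show ?thesis
      proof (rule perturb[OF Suc.prems(3) l(1) Suc.prems(1)])
        fix \<epsilon> :: complex assume eps: "\<epsilon> \<noteq> 0"
        let ?v = "\<lambda>i. \<epsilon> * evec ?K i"
        have v: "?v \<in> Vsp n" "?v l = 0" using K l by (auto simp: Vsp_def evec_apply)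
        \<comment> \<open>\<open>?b\<close> is the image of \<open>b\<close> under the isomorphism
          onto \<open>?c\<close>, so it keeps the absorption property, while its entry at
          \<open>?K\<close> becomes \<open>\<epsilon> * b l\<close>.\<close>
        let ?c = "tact n l ?v c" and ?b = "transvec l ?v b"
        show "Q ?K ?c"
        proof (rule *[of ?c ?b])
          show "?c \<in> NilVar n" using NilVar_orbit[OF Suc.prems(1) tact_orbit] v cS by auto
          show "tri_above n ?K ?c" using tri_above_tact[OF Suc.prems(2)] l v cS by simp
          show "?b \<in> Vsp n" using linmapD(1)[OF linmap_transvec[OF v(1)]] b(1) by blast
          show "?b ?K \<noteq> 0" using True l eps by (simp add: transvec_def evec_apply)
          fix z assume z: "z \<in> Vsp n"
          let ?z = "transvec l (\<lambda>i. - ?v i) z"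
          have z': "?z \<in> Vsp n" using linmapD(1)[OF linmap_transvec[OF uminus_Vsp[OF v(1)]] z] .
          have "amult n c ?z b \<in> Tail (Suc ?K)" "amult n c b ?z \<in> Tail (Suc ?K)"
            using b(3)[OF z'] by auto
          moreover have "transvec l (\<lambda>i. - ?v i) ?b = b" by (rule transvec_inverse) (rule v(2))
          moreover have "transvec l ?v y = y" if "y \<in> Tail (Suc ?K)" for y
            using transvec_Tail[OF that] l by simp
          ultimately show "amult n ?c z ?b \<in> Tail (Suc ?K) \<and> amult n ?c ?b z \<in> Tail (Suc ?K)"
            using amult_tact[OF v(1) cS] z linmapD(1)[OF linmap_transvec[OF v(1)] b(1)] by simp
        qed
      qed
    qed
  qed
  moreover have "tri_above n n c" by (auto simp: tri_above_def)
  ultimately show ?thesis using c by blast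
qed

section \<open>A uniform nilpotency exponent, and closedness of the nilpotent variety\<close>

lemma NilVar_bound:
  assumes "c \<in> NilVar n" "pw n c (2 ^ n) x"
  shows "x = 0"
proof -
  \<comment> \<open>The predicate ignores its index and is invariant under isomorphism, so both
    inductive rules just go back through a transvection; for the perturbation the single value
    \<open>\<epsilon> = 1\<close> suffices.\<close>
  define Q where "Q = (\<lambda>(k::nat) c. \<forall>x. pw n c (2 ^ n) x \<longrightarrow> x = 0)"
  have inv: "Q k c" if "Q k' (tact n l v c)" "v \<in> Vsp n" "v l = 0" "c \<in> Str n" for k k' l v c
  proof -
    have "c \<in> orbit n (tact n l v c)"
      using orbit_sym[OF that(4) tact_orbit[OF that(2-4)]] .
    then show ?thesis using that(1) pw_orbit[OF tact_Str] unfolding Q_def by metis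
  qed
  have "Q n c"
  proof (rule nilpotent_triangularize[OF _ _ _ assms(1)])
    show "Q 0 c" if "c \<in> tri n" for c using tri_nil_bound[OF that] by (auto simp: Q_def)
  next
    fix k v c assume "Suc k \<le> n" "c \<in> NilVar n" "v \<in> Vsp n" "\<And>i. i \<ge> Suc k \<Longrightarrow> v i = 0"
      "Q k (tact n (Suc k) (\<lambda>i. - v i) c)"
    then show "Q (Suc k) c"
      using inv[of k "Suc k" "\<lambda>i. - v i" c "Suc k"] by (auto simp: NilVar_def)
  next
    fix k l c assume *: "Suc k \<le> n" "l \<le> k" "c \<in> NilVar n"
      "\<And>\<epsilon>. \<epsilon> \<noteq> 0 \<Longrightarrow> Q (Suc k) (tact n l (\<lambda>i. \<epsilon> * evec (Suc k) i) c)"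
    show "Q (Suc k) c"
      by (rule inv[OF *(4)[of 1]]) (use * in \<open>auto simp: NilVar_def Vsp_def evec_apply\<close>)
  qed
  then show ?thesis using assms(2) by (simp add: Q_def)
qed

text \<open>The rules of \<open>pw\<close> with the derivation frozen and the structure left
  variable. Each derivation thus becomes a polynomial map, and the maps of index
  \<open>2 ^ n\<close> are the equations of the nilpotent variety.\<close>

inductive pwpoly :: "nat \<Rightarrow> nat \<Rightarrow> (struct \<Rightarrow> vec) \<Rightarrow> bool" for n where
  "x \<in> Vsp n \<Longrightarrow> pwpoly n 1 (\<lambda>c. x)"
| "k \<ge> 1 \<Longrightarrow> pwpoly n k (\<lambda>c. 0)"
| "pwpoly n i X \<Longrightarrow> pwpoly n j Y \<Longrightarrow> pwpoly n (i + j) (\<lambda>c. amult n c (X c) (Y c))"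
| "pwpoly n k X \<Longrightarrow> pwpoly n k Y \<Longrightarrow> pwpoly n k (\<lambda>c. X c + Y c)"
| "pwpoly n k X \<Longrightarrow> pwpoly n k (\<lambda>c t. a * X c t)"

lemma polymap_pwpoly: "pwpoly n k X \<Longrightarrow> polymap X"
proof (induction rule: pwpoly.induct)
  case (3 i X j Y)
  show ?case using polymap_amult[OF polymap_id 3(3,4)] .
next
  case (4 k X Y)
  show ?case using polymap_add[OF 4(3,4)] .
next
  case (5 k X a)
  show ?case using polymap_scale[OF 5(2)] .
qed (rule polymap_const)+

lemma pw_pwpoly: "pwpoly n k X \<Longrightarrow> pw n c k (X c)"
proof (induction rule: pwpoly.induct)
  case (1 x)
  then show ?case by (rule pw.base)
next
  case (2 k)
  then show ?case by (rule pw.zero)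
next
  case (3 i X j Y)
  show ?case using pw.prod[OF 3(3,4)] .
next
  case (4 k X Y)
  show ?case using pw.add[OF 4(3,4)] .
next
  case (5 k X a)
  show ?case using pw.smult[OF 5(2)] .
qed

lemma pwpoly_pw: "pw n c k x \<Longrightarrow> \<exists>X. pwpoly n k X \<and> X c = x"
proof (induction rule: pw.induct)
  case (base x)
  then show ?case using pwpoly.intros(1) by blast
next
  case (zero k)
  then show ?case using pwpoly.intros(2) by blast
next
  case (prod i x j y)
  then obtain X Y where "pwpoly n i X" "X c = x" "pwpoly n j Y" "Y c = y" by blast
  then show ?case using pwpoly.intros(3)[of n i X j Y] by blast
next
  case (add k x y)
  then obtain X Y where "pwpoly n k X" "X c = x" "pwpoly n k Y" "Y c = y" by blast
  then show ?case using pwpoly.intros(4)[of n k X Y] by blast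
next
  case (smult k x a)
  then obtain X where "pwpoly n k X" "X c = x" by blast
  then show ?case using pwpoly.intros(5)[of n k X a] by blast
qed

lemma zclosed_NilVar: "zclosed n (NilVar n)"
proof -
  let ?P = "{\<lambda>c. X c t | X t. pwpoly n (2 ^ n) X}"
  have "?P \<subseteq> polyfun" using polymapD[OF polymap_pwpoly] by blast
  moreover have "NilVar n = {c \<in> Str n. \<forall>p\<in>?P. p c = 0}"
  proof (intro set_eqI iffI)
    fix c assume c: "c \<in> NilVar n"
    have "X c = 0" if "pwpoly n (2 ^ n) X" for X
      using NilVar_bound[OF c pw_pwpoly[OF that]] .
    then show "c \<in> {c \<in> Str n. \<forall>p\<in>?P. p c = 0}" using c by (auto simp: NilVar_def)
  next
    fix c assume c: "c \<in> {c \<in> Str n. \<forall>p\<in>?P. p c = 0}"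
    have z: "X c t = 0" if X: "pwpoly n (2 ^ n) X" for X t
    proof -
      have "(\<lambda>c. X c t) \<in> ?P" using X by blast
      moreover have "\<forall>p\<in>?P. p c = 0" using c by simp
      ultimately show ?thesis by (rule bspec[rotated])
    qed
    have "x = 0" if x: "pw n c (2 ^ n) x" for x
    proof -
      obtain X where "pwpoly n (2 ^ n) X" "X c = x" using pwpoly_pw[OF x] by blast
      then show ?thesis using z[of X] by (metis ext zero_fun_apply)
    qed
    then show "c \<in> NilVar n" using c unfolding NilVar_def nilpotent_str_def
      by (auto intro!: exI[of _ "2 ^ n"])
  qed
  ultimately show ?thesis unfolding zclosed_def by blast
qed

text \<open>\<open>Q k c\<close> puts \<open>c\<close> into the closure of the image of
  \<open>Phi n k\<close>. Each inductive rule replaces the tested polynomial: elimination composes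
  it with a fixed transvection, perturbation restricts it to a one-parameter family.\<close>

lemma polyfun_vanish_NilVar:
  assumes "c \<in> NilVar n" "p \<in> polyfun" "\<And>s. p (Phi n n s) = 0"
  shows "p c = 0"
proof -
  define Q where "Q k c \<longleftrightarrow> (\<forall>p\<in>polyfun. (\<forall>s. p (Phi n k s) = 0) \<longrightarrow> p c = 0)" for k c
  have "Q n c"
  proof (rule nilpotent_triangularize[OF _ _ _ assms(1)])
    show "Q 0 c" if "c \<in> tri n" for c using trunc_id[OF that] by (auto simp: Q_def) metis
  next
    fix k v c assume *: "Suc k \<le> n" "c \<in> NilVar n" "v \<in> Vsp n" "\<And>i. i \<ge> Suc k \<Longrightarrow> v i = 0"
      "Q k (tact n (Suc k) (\<lambda>i. - v i) c)"
    show "Q (Suc k) c"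
      unfolding Q_def
    proof (intro ballI impI)
      fix p assume p: "p \<in> polyfun" "\<forall>s. p (Phi n (Suc k) s) = 0"
      have q: "(\<lambda>c. p (tact n (Suc k) v c)) \<in> polyfun"
        by (intro polyfun_comp[OF p(1)] polymap_tact polymap_const polymap_id)
      have r: "p (tact n (Suc k) v (Phi n k s)) = 0" for s
      proof -
        \<comment> \<open>Overwriting column \<open>Suc k\<close> with \<open>v\<close> does not
          affect stage k, so the transvected point is a value of
          \<open>Phi n (Suc k)\<close>.\<close>
        define s' where "s' = (\<lambda>(i, j, m). if j = Suc k \<and> m = 0 then v i else s (i, j, m))"
        have "Phi n k s' = Phi n k s" by (rule Phi_cong) (auto simp: s'_def Tpos_def)
        moreover have "col (Suc k) s' = v"
          using *(4) VspD[OF *(3), of 0]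
          by (auto simp: col_def s'_def fun_eq_iff not_less less_Suc_eq_le Suc_le_eq)
        ultimately have "Phi n (Suc k) s' = tact n (Suc k) v (Phi n k s)" by simp
        then show ?thesis using p(2) by metis
      qed
      have "p (tact n (Suc k) v (tact n (Suc k) (\<lambda>i. - v i) c)) = 0"
        using *(5)[unfolded Q_def, rule_format, OF q r] .
      then show "p c = 0" using tact_tact_inverse[of v n "Suc k" c] * by (simp add: NilVar_def)
    qed
  next
    fix k l c assume *: "Suc k \<le> n" "l \<le> k" "c \<in> NilVar n"
      "\<And>\<epsilon>. \<epsilon> \<noteq> 0 \<Longrightarrow> Q (Suc k) (tact n l (\<lambda>i. \<epsilon> * evec (Suc k) i) c)"
    show "Q (Suc k) c"
      unfolding Q_def
    proof (intro ballI impI)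
      fix p assume p: "p \<in> polyfun" "\<forall>s. p (Phi n (Suc k) s) = 0"
      \<comment> \<open>Elements of \<open>polyfun\<close> take structures as arguments, so the
        coordinate \<open>(0, 0, 0)\<close>, never a structure constant, plays the parameter
        \<open>\<epsilon>\<close>.\<close>
      let ?p = "\<lambda>s. p (tact n l (\<lambda>i. s (0, 0, 0) * evec (Suc k) i) c)"
      have "?p \<in> polyfun"
        by (intro polyfun_comp[OF p(1)] polymap_tact polymap_const)
          (auto simp: polymap_def intro: pmult pvar pconst)
      moreover have "?p (\<lambda>v. 0 + z * 1) = 0" if "z \<noteq> 0" for z
        using *(4)[OF that] p unfolding Q_def by simp
      ultimately have "?p (\<lambda>v. 0) = 0" by (rule polyfun_line_zero)
      then show "p c = 0" using * by (simp add: tact_zero NilVar_def)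
    qed
  qed
  then show ?thesis using assms by (auto simp: Q_def)
qed

subsection \<open>Chains of irreducible sets and algebraic independence\<close>

text \<open>A homogeneous system with more unknowns than equations. One elimination step with pivot
  \<open>A i0 j\<close> removes an equation and an unknown; \<open>l0\<close> is the back
  substitution.\<close>

lemma dependent_rows:
  fixes A :: "'i \<Rightarrow> 'j \<Rightarrow> 'a :: field"
  assumes "finite J" "finite I" "card J < card I"
  shows "\<exists>l. (\<exists>i\<in>I. l i \<noteq> 0) \<and> (\<forall>j\<in>J. (\<Sum>i\<in>I. l i * A i j) = 0)"
  using assms
proof (induction J arbitrary: I A)
  case empty
  then have "I \<noteq> {}" by auto
  then show ?case by (intro exI[of _ "\<lambda>_. 1"]) auto
next
  case (insert j J)
  show ?case
  proof (cases "\<forall>i\<in>I. A i j = 0")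
    case True
    have "card J < card I" using insert by auto
    then obtain l where "\<exists>i\<in>I. l i \<noteq> 0" "\<forall>j\<in>J. (\<Sum>i\<in>I. l i * A i j) = 0"
      using insert.IH[of I A] insert.prems by blast
    then show ?thesis using True by (intro exI[of _ l]) auto
  next
    case False
    then obtain i0 where i0: "i0 \<in> I" "A i0 j \<noteq> 0" by blast
    define A' where "A' i k = A i k - A i j / A i0 j * A i0 k" for i k
    have "card J < card (I - {i0})" using insert i0 by simp
    then obtain l where l: "\<exists>i\<in>I - {i0}. l i \<noteq> 0"
      "\<forall>k\<in>J. (\<Sum>i\<in>I - {i0}. l i * A' i k) = 0"
      using insert.IH[of "I - {i0}" A'] insert.prems by blast
    define l0 where "l0 = - (\<Sum>i\<in>I - {i0}. l i * (A i j / A i0 j))"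
    have S: "(\<Sum>i\<in>I. (l(i0 := l0)) i * A i k) = (\<Sum>i\<in>I - {i0}. l i * A' i k)" for k
    proof -
      have "(\<Sum>i\<in>I. (l(i0 := l0)) i * A i k) = l0 * A i0 k + (\<Sum>i\<in>I - {i0}. l i * A i k)"
        using i0 insert.prems by (simp add: sum.remove[of I i0])
      also have "\<dots> = (\<Sum>i\<in>I - {i0}. l i * A' i k)"
        by (simp add: l0_def A'_def sum_distrib_right right_diff_distrib sum_subtractf mult.assoc)
      finally show ?thesis .
    qed
    have "A' i j = 0" for i using i0 by (simp add: A'_def)
    then show ?thesis using l S by (intro exI[of _ "l(i0 := l0)"]) auto
  qed
qed

text \<open>Degree at most D in each variable separately rather than in total: the exponents then
  form a box with exactly \<open>(D + 1) ^ card S\<close> points.\<close>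

inductive box_poly :: "(nat \<times> nat \<times> nat) set \<Rightarrow> nat \<Rightarrow> (struct \<Rightarrow> complex) \<Rightarrow> bool" for S D where
  box_mono: "(\<And>v. v \<in> S \<Longrightarrow> a v \<le> D) \<Longrightarrow> box_poly S D (\<lambda>s. b * (\<Prod>v\<in>S. s v ^ a v))"
| box_add: "box_poly S D f \<Longrightarrow> box_poly S D g \<Longrightarrow> box_poly S D (\<lambda>s. f s + g s)"

lemma box_poly_mono: "box_poly S D f \<Longrightarrow> D \<le> E \<Longrightarrow> box_poly S E f"
  by (induction rule: box_poly.induct) (auto intro!: box_poly.intros intro: le_trans)

lemma box_poly_const: "box_poly S D (\<lambda>s. b)"
  using box_mono[of S "\<lambda>_. 0" D b] by simp

lemma box_poly_var:
  assumes "finite S" "v \<in> S"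
  shows "box_poly S 1 (\<lambda>s. s v)"
proof -
  have "(\<Prod>w\<in>S. s w ^ (if w = v then 1 else 0)) = s v" for s :: struct
    using assms by (simp add: if_distrib[of "power _"] prod.delta cong: if_cong)
  then show ?thesis using box_mono[of S "\<lambda>w. if w = v then 1 else 0" 1 1] by simp
qed

lemma box_poly_mult:
  assumes "box_poly S D f" "box_poly S E g"
  shows "box_poly S (D + E) (\<lambda>s. f s * g s)"
  using assms(1)
proof induction
  case (box_mono a b)
  from assms(2) show ?case
  proof induction
    case (box_mono a' b')
    have "(\<lambda>s. b * (\<Prod>v\<in>S. s v ^ a v) * (b' * (\<Prod>v\<in>S. s v ^ a' v)))
        = (\<lambda>s. (b * b') * (\<Prod>v\<in>S. s v ^ (a v + a' v)))"
      by (simp add: power_add prod.distrib mult_ac)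
    then show ?case
      using box_poly.box_mono[of S "\<lambda>v. a v + a' v" "D + E" "b * b'"] box_mono \<open>\<And>v. v \<in> S \<Longrightarrow> a v \<le> D\<close>
      by (simp add: add_mono)
  next
    case (box_add f g)
    then show ?case using box_poly.box_add by (simp add: distrib_left)
  qed
next
  case (box_add f g)
  then show ?case using box_poly.box_add by (simp add: distrib_right)
qed

lemma box_poly_power: "box_poly S D f \<Longrightarrow> box_poly S (k * D) (\<lambda>s. f s ^ k)"
  by (induction k) (auto intro: box_poly_const box_poly_mult)

lemma polyfun_box_poly:
  assumes "p \<in> polyfun" "finite S"
  shows "\<exists>D g. box_poly S D g \<and> (\<forall>s\<in>coordsp S. p s = g s)"
  using assms(1)
proof induction
  case (pconst a)
  then show ?case using box_poly_const by blast
next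
  case (pvar v)
  show ?case
  proof (cases "v \<in> S")
    case True
    then show ?thesis using box_poly_var[OF assms(2)] by blast
  next
    case False
    then show ?thesis using box_poly_const[of S 0 0] unfolding coordsp_def by blast
  qed
next
  case (padd p q)
  then obtain D g E h where "box_poly S D g" "\<forall>s\<in>coordsp S. p s = g s"
    "box_poly S E h" "\<forall>s\<in>coordsp S. q s = h s" by blast
  then have "box_poly S (max D E) (\<lambda>s. g s + h s)" "\<forall>s\<in>coordsp S. p s + q s = g s + h s"
    using box_add[OF box_poly_mono[of S D g "max D E"] box_poly_mono[of S E h "max D E"]] by auto
  then show ?case by blast
next
  case (pmult p q)
  then obtain D g E h where "box_poly S D g" "\<forall>s\<in>coordsp S. p s = g s"
    "box_poly S E h" "\<forall>s\<in>coordsp S. q s = h s" by blast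
  then have "box_poly S (D + E) (\<lambda>s. g s * h s)" "\<forall>s\<in>coordsp S. p s * q s = g s * h s"
    by (auto intro: box_poly_mult)
  then show ?case by blast
qed

lemma box_poly_coeffs:
  assumes "box_poly S D f" "finite S"
  shows "\<exists>u. \<forall>s. f s = (\<Sum>a\<in>S \<rightarrow>\<^sub>E {..D}. u a * (\<Prod>v\<in>S. s v ^ a v))"
  using assms(1)
proof induction
  case (box_mono a b)
  let ?a = "restrict a S"
  have fin: "finite (S \<rightarrow>\<^sub>E {..D})" using assms(2) by (intro finite_PiE) auto
  have mem: "?a \<in> S \<rightarrow>\<^sub>E {..D}" using box_mono by auto
  have "b * (\<Prod>v\<in>S. s v ^ a v) =
      (\<Sum>a'\<in>S \<rightarrow>\<^sub>E {..D}. (if a' = ?a then b else 0) * (\<Prod>v\<in>S. s v ^ a' v))" for s :: struct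
    using fin mem by (simp add: if_distrib[of "\<lambda>x. x * _"] sum.delta' cong: if_cong)
  then show ?case by (intro exI[of _ "\<lambda>a'. if a' = ?a then b else 0"]) blast
next
  case (box_add f g)
  then obtain u w where "\<forall>s. f s = (\<Sum>a\<in>S \<rightarrow>\<^sub>E {..D}. u a * (\<Prod>v\<in>S. s v ^ a v))"
     "\<forall>s. g s = (\<Sum>a\<in>S \<rightarrow>\<^sub>E {..D}. w a * (\<Prod>v\<in>S. s v ^ a v))" by blast
  then show ?case by (intro exI[of _ "\<lambda>a. u a + w a"]) (simp add: sum.distrib distrib_right)
qed

section \<open>Monomials in the separating functions of a chain\<close>

definition expos :: "nat \<Rightarrow> nat \<Rightarrow> nat list set" where
  "expos N m = {a. set a \<subseteq> {..N} \<and> length a = m}"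

lemma finite_expos [simp]: "finite (expos N m)"
  unfolding expos_def by (rule finite_lists_length_eq) simp

lemma card_expos: "card (expos N m) = (N + 1) ^ m"
  unfolding expos_def by (subst card_lists_length_eq) auto

text \<open>The head of the list is the exponent of the function with the highest index, so consing
  passes from the first k functions to the first k + 1, in step with the chain.\<close>

fun monom_at :: "(nat \<Rightarrow> struct \<Rightarrow> complex) \<Rightarrow> nat list \<Rightarrow> struct \<Rightarrow> complex" where
  "monom_at f [] c = 1"
| "monom_at f (j # a) c = f (length a) c ^ j * monom_at f a c"

lemma sum_expos_Suc:
  "(\<Sum>a\<in>expos N (Suc k). F a) = (\<Sum>j\<le>N. \<Sum>a\<in>expos N k. F (j # a))"
proof -
  have "expos N (Suc k) = (\<lambda>(j, a). j # a) ` ({..N} \<times> expos N k)"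
    by (auto simp: expos_def length_Suc_conv image_iff)
  moreover have "inj_on (\<lambda>(j, a). j # a) ({..N} \<times> expos N k)" by (auto simp: inj_on_def)
  ultimately show ?thesis by (simp add: sum.reindex sum.cartesian_product case_prod_unfold comp_def)
qed

lemma polyfun_power: "f \<in> polyfun \<Longrightarrow> (\<lambda>s. f s ^ k) \<in> polyfun"
  by (induction k) (auto intro: pconst pmult)

lemma polyfun_monom_at: "(\<And>i. i < length a \<Longrightarrow> f i \<in> polyfun) \<Longrightarrow> monom_at f a \<in> polyfun"
proof (induction a)
  case Nil
  have "monom_at f [] = (\<lambda>c. 1)" by auto
  then show ?case by (simp add: pconst)
next
  case (Cons j a)
  have "monom_at f (j # a) = (\<lambda>c. f (length a) c ^ j * monom_at f a c)" by auto
  then show ?case using Cons by (simp add: pmult polyfun_power)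
qed

text \<open>The coordinate ring of an irreducible closed set is a domain: the zero sets of
  \<open>f\<close> and \<open>g\<close> cover \<open>Z\<close>.\<close>

lemma zirreducible_mult_zero:
  assumes "zirreducible n Z" "zclosed n Z" "f \<in> polyfun" "g \<in> polyfun"
    and "\<And>c. c \<in> Z \<Longrightarrow> f c * g c = 0"
  shows "(\<forall>c\<in>Z. f c = 0) \<or> (\<forall>c\<in>Z. g c = 0)"
proof -
  have cl: "zclosed n {c \<in> Str n. f c = 0}" if "f \<in> polyfun" for f
    unfolding zclosed_def using that by (intro exI[of _ "{f}"]) auto
  have "Z \<subseteq> Str n" using assms(2) by (auto simp: zclosed_def)
  then have "Z \<subseteq> {c \<in> Str n. f c = 0} \<union> {c \<in> Str n. g c = 0}" using assms(5) by auto
  then have "Z \<subseteq> {c \<in> Str n. f c = 0} \<or> Z \<subseteq> {c \<in> Str n. g c = 0}"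
    using assms(1) cl[OF assms(3)] cl[OF assms(4)] unfolding zirreducible_def by blast
  then show ?thesis by blast
qed

text \<open>Write a relation as \<open>\<Sum>\<^sub>j f\<^sub>k\<^sup>j G\<^sub>j\<close> and divide by the lowest power of \<open>f\<^sub>k\<close> that occurs,
  which is allowed on the irreducible set \<open>Z (Suc k)\<close>. Restricting the quotient to \<open>Z k\<close>, where \<open>f\<^sub>k\<close>
  vanishes, leaves the lowest coefficient.\<close>

lemma chain_algebraically_independent:
  assumes Z: "\<And>i. i \<le> m \<Longrightarrow> zclosed n (Z i)" "\<And>i. i \<le> m \<Longrightarrow> zirreducible n (Z i)"
      "\<And>i. i < m \<Longrightarrow> Z i \<subseteq> Z (Suc i)"
    and f: "\<And>i. i < m \<Longrightarrow> f i \<in> polyfun" "\<And>i c. i < m \<Longrightarrow> c \<in> Z i \<Longrightarrow> f i c = 0"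
      "\<And>i. i < m \<Longrightarrow> \<exists>c\<in>Z (Suc i). f i c \<noteq> 0"
    and "k \<le> m" and "\<And>c. c \<in> Z k \<Longrightarrow> (\<Sum>a\<in>expos N k. l a * monom_at f a c) = 0"
  shows "\<forall>a\<in>expos N k. l a = 0"
  using assms(7,8)
proof (induction k arbitrary: l)
  case 0
  have e: "expos N 0 = {[]}" by (auto simp: expos_def)
  obtain c where "c \<in> Z 0" using Z(2)[of 0] by (auto simp: zirreducible_def)
  then show ?case using 0(2)[of c] by (simp add: e)
next
  case (Suc k)
  define G where "G j c = (\<Sum>a\<in>expos N k. l (j # a) * monom_at f a c)" for j c
  have k: "k < m" using Suc.prems by simp
  show ?case
  proof (rule ccontr)
    assume "\<not> ?thesis"
    then obtain a where a: "a \<in> expos N (Suc k)" "l a \<noteq> 0" by blast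
    \<comment> \<open>\<open>R\<close> tests the formal coefficients of the j-th power, not the
      values of \<open>G j\<close>; the induction hypothesis later turns the vanishing of
      \<open>G j0\<close> on \<open>Z k\<close> into vanishing coefficients.\<close>
    define R where "R j \<longleftrightarrow> j \<le> N \<and> (\<exists>a\<in>expos N k. l (j # a) \<noteq> 0)" for j
    have "\<exists>j. R j" using a by (cases a) (auto simp: R_def expos_def)
    define j0 where "j0 = (LEAST j. R j)"
    have j0: "R j0" using \<open>\<exists>j. R j\<close> unfolding j0_def by (rule LeastI_ex)
    have less: "G j c = 0" if "j < j0" for j c
    proof -
      have "\<not> R j" "j \<le> N" using that not_less_Least[of j R] j0 by (auto simp: j0_def R_def)
      then show ?thesis by (auto simp: G_def R_def intro!: sum.neutral)
    qed
    define H where "H c = (\<Sum>j\<in>{j0..N}. f k c ^ (j - j0) * G j c)" for c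
    have eq: "(\<Sum>a\<in>expos N (Suc k). l a * monom_at f a c) = f k c ^ j0 * H c" for c
    proof -
      have "(\<Sum>a\<in>expos N (Suc k). l a * monom_at f a c) = (\<Sum>j\<le>N. f k c ^ j * G j c)"
        unfolding sum_expos_Suc G_def sum_distrib_left
        by (intro sum.cong refl) (auto simp: expos_def mult_ac)
      also have "\<dots> = (\<Sum>j\<in>{j0..N}. f k c ^ j * G j c)"
        by (rule sum.mono_neutral_right) (auto simp: less)
      also have "\<dots> = f k c ^ j0 * H c"
        unfolding H_def sum_distrib_left
        by (intro sum.cong refl) (simp flip: power_add mult.assoc)
      finally show ?thesis .
    qed
    have Gp: "G j \<in> polyfun" for j
      unfolding G_def using k
      by (intro polyfun_sum pmult pconst polyfun_monom_at f(1)) (auto simp: expos_def)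
    have Hp: "H \<in> polyfun"
      unfolding H_def by (intro polyfun_sum pmult polyfun_power f(1) Gp k)
    have "f k c * H c = 0" if "c \<in> Z (Suc k)" for c
      using Suc.prems(2)[OF that] eq[of c] by auto
    then have "(\<forall>c\<in>Z (Suc k). f k c = 0) \<or> (\<forall>c\<in>Z (Suc k). H c = 0)"
      using zirreducible_mult_zero[OF Z(2,1) f(1)[OF k] Hp] Suc.prems(1) by blast
    then have H0: "H c = 0" if "c \<in> Z k" for c using f(3)[OF k] Z(3)[OF k] that by blast
    have "G j0 c = 0" if "c \<in> Z k" for c
    proof -
      have "H c = (\<Sum>j\<in>{j0..N}. if j = j0 then G j c else 0)"
        unfolding H_def using f(2)[OF k that] by (intro sum.cong refl) (auto simp: power_0_left)
      also have "\<dots> = G j0 c" using j0 by (simp add: R_def)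
      finally show ?thesis using H0[OF that] by simp
    qed
    then have "\<forall>a\<in>expos N k. l (j0 # a) = 0"
      using Suc.IH[of "\<lambda>a. l (j0 # a)"] k by (simp add: G_def)
    then show False using j0 by (auto simp: R_def)
  qed
qed

text \<open>The choice \<open>B ^ d\<close> for N makes the constant factor \<open>B ^ d\<close>
  equal to N itself, so one extra factor N + 1 absorbs it.\<close>

lemma box_growth:
  fixes C d m :: nat
  assumes "d < m"
  shows "\<exists>N. (C * N + 1) ^ d < (N + 1) ^ m"
proof -
  define B where "B = C + 1"
  let ?N = "B ^ d"
  have "(C * ?N + 1) ^ d \<le> (B * (?N + 1)) ^ d"
    by (intro power_mono) (auto simp: B_def)
  also have "\<dots> = ?N * (?N + 1) ^ d" by (rule power_mult_distrib)
  also have "\<dots> < (?N + 1) ^ Suc d" by simp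
  also have "\<dots> \<le> (?N + 1) ^ m" using assms by (intro power_increasing) auto
  finally show ?thesis by blast
qed

text \<open>Pulled back along \<open>F\<close>, the \<open>(N + 1) ^ m\<close> monomials in the m
  separating functions have degree at most \<open>m * D * N\<close> in each variable, so they span
  at most \<open>(m * D * N + 1) ^ card S\<close> dimensions. For m > \<open>card S\<close> and
  suitable N this forces a linear relation, which hypothesis \<open>X\<close> carries over to the
  top of the chain.\<close>

lemma zchain_length_le:
  assumes S: "finite S" and F: "polymap F"
    and X: "\<And>p c. p \<in> polyfun \<Longrightarrow> (\<And>s. s \<in> coordsp S \<Longrightarrow> p (F s) = 0) \<Longrightarrow> c \<in> X \<Longrightarrow> p c = 0"
    and "zchain n X m"
  shows "m \<le> card S"
proof (rule ccontr)
  assume "\<not> m \<le> card S"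
  from assms(4) obtain Z where Z: "\<And>i. i \<le> m \<Longrightarrow> zclosed n (Z i)" "\<And>i. i \<le> m \<Longrightarrow> zirreducible n (Z i)"
      "\<And>i. i \<le> m \<Longrightarrow> Z i \<subseteq> X" "\<And>i. i < m \<Longrightarrow> Z i \<subset> Z (Suc i)"
    unfolding zchain_def by blast
  have "\<exists>p. p \<in> polyfun \<and> (\<forall>c\<in>Z i. p c = 0) \<and> (\<exists>c\<in>Z (Suc i). p c \<noteq> 0)" if i: "i < m" for i
  proof -
    obtain x where x: "x \<in> Z (Suc i)" "x \<notin> Z i" using Z(4)[OF i] by blast
    moreover have "Z (Suc i) \<subseteq> Str n" using Z(1)[of "Suc i"] i by (auto simp: zclosed_def)
    ultimately show ?thesis using zclosed_separate[OF Z(1)[of i], of x] i by (metis less_imp_le subsetD)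
  qed
  then obtain f where f: "\<And>i. i < m \<Longrightarrow> f i \<in> polyfun" "\<And>i c. i < m \<Longrightarrow> c \<in> Z i \<Longrightarrow> f i c = 0"
      "\<And>i. i < m \<Longrightarrow> \<exists>c\<in>Z (Suc i). f i c \<noteq> 0"
    by metis
  have "\<forall>i. \<exists>D g. i < m \<longrightarrow> box_poly S D g \<and> (\<forall>s\<in>coordsp S. f i (F s) = g s)"
    using polyfun_box_poly[OF polyfun_comp[OF f(1) F] S] by blast
  then obtain D0 g where g0: "\<And>i. i < m \<Longrightarrow> box_poly S (D0 i) (g i)"
      "\<And>i s. i < m \<Longrightarrow> s \<in> coordsp S \<Longrightarrow> f i (F s) = g i s"
    by metis
  define D where "D = Max (D0 ` {..<m})"
  have g: "box_poly S D (g i)" if "i < m" for i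
    using box_poly_mono[OF g0(1)[OF that]] that by (simp add: D_def)
  obtain N where N: "((m * D) * N + 1) ^ card S < (N + 1) ^ m"
    using box_growth \<open>\<not> m \<le> card S\<close> by (metis not_le)
  have mon: "box_poly S (length a * D * N) (monom_at g a) \<and>
      (\<forall>s\<in>coordsp S. monom_at f a (F s) = monom_at g a s)"
    if "set a \<subseteq> {..N}" "length a \<le> m" for a
    using that
  proof (induction a)
    case Nil
    then show ?case by (simp add: box_poly_const)
  next
    case (Cons j a)
    then have IH: "box_poly S (length a * D * N) (monom_at g a)"
      "\<forall>s\<in>coordsp S. monom_at f a (F s) = monom_at g a s" and l: "length a < m" by auto
    have "j * D \<le> D * N" using Cons by simp
    then have "box_poly S (D * N) (\<lambda>s. g (length a) s ^ j)"
      using box_poly_mono[OF box_poly_power[OF g[OF l]]] by blast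
    from box_poly_mult[OF this IH(1)] show ?case using IH(2) g0(2)[OF l] by (simp add: algebra_simps)
  qed
  have ex: "\<exists>u. \<forall>s\<in>coordsp S. monom_at f a (F s) =
      (\<Sum>b\<in>S \<rightarrow>\<^sub>E {..m * D * N}. u b * (\<Prod>v\<in>S. s v ^ b v))"
    if "a \<in> expos N m" for a
    using mon[of a] box_poly_coeffs[OF _ S, of "m * D * N" "monom_at g a"] that
    by (auto simp: expos_def)
  have "\<exists>u. \<forall>a\<in>expos N m. \<forall>s\<in>coordsp S. monom_at f a (F s) =
      (\<Sum>b\<in>S \<rightarrow>\<^sub>E {..m * D * N}. u a b * (\<Prod>v\<in>S. s v ^ b v))"
    by (rule bchoice, rule ballI, rule ex)
  then obtain u where u: "\<And>a s. a \<in> expos N m \<Longrightarrow> s \<in> coordsp S \<Longrightarrow> monom_at f a (F s) =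
      (\<Sum>b\<in>S \<rightarrow>\<^sub>E {..m * D * N}. u a b * (\<Prod>v\<in>S. s v ^ b v))"
    by blast
  have "finite (S \<rightarrow>\<^sub>E {..m * D * N})" using S by (intro finite_PiE) auto
  moreover have "card (S \<rightarrow>\<^sub>E {..m * D * N}) < card (expos N m)"
    using N S by (simp add: card_PiE card_expos)
  ultimately obtain l where l: "\<exists>a\<in>expos N m. l a \<noteq> 0"
      "\<And>b. b \<in> S \<rightarrow>\<^sub>E {..m * D * N} \<Longrightarrow> (\<Sum>a\<in>expos N m. l a * u a b) = 0"
    using dependent_rows[of "S \<rightarrow>\<^sub>E {..m * D * N}" "expos N m" u] by auto
  have "(\<Sum>a\<in>expos N m. l a * monom_at f a (F s)) = 0" if s: "s \<in> coordsp S" for s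
  proof -
    have "(\<Sum>a\<in>expos N m. l a * monom_at f a (F s)) =
        (\<Sum>a\<in>expos N m. \<Sum>b\<in>S \<rightarrow>\<^sub>E {..m * D * N}. l a * (u a b * (\<Prod>v\<in>S. s v ^ b v)))"
      by (intro sum.cong refl) (simp add: u s sum_distrib_left)
    also have "\<dots> = (\<Sum>b\<in>S \<rightarrow>\<^sub>E {..m * D * N}. (\<Sum>a\<in>expos N m. l a * u a b) * (\<Prod>v\<in>S. s v ^ b v))"
      by (subst sum.swap) (simp add: sum_distrib_right mult.assoc)
    also have "\<dots> = 0" using l(2) by simp
    finally show ?thesis .
  qed
  moreover have "(\<lambda>c. \<Sum>a\<in>expos N m. l a * monom_at f a c) \<in> polyfun"
    by (intro polyfun_sum pmult pconst polyfun_monom_at f(1)) (auto simp: expos_def)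
  ultimately have "(\<Sum>a\<in>expos N m. l a * monom_at f a c) = 0" if "c \<in> Z m" for c
    using X[of "\<lambda>c. \<Sum>a\<in>expos N m. l a * monom_at f a c" c] Z(3)[of m] that by blast
  then have "\<forall>a\<in>expos N m. l a = 0"
    using chain_algebraically_independent[of m n Z f m] Z f by blast
  then show False using l(1) by blast
qed

subsection \<open>A maximal chain in the nilpotent variety\<close>

lemma Tpos_Suc: "Tpos (Suc n) = Tpos n \<union> (\<lambda>(i, j). (i, j, Suc n)) ` ({1..n} \<times> {1..n})"
  by (auto simp: Tpos_def image_iff le_Suc_eq)

lemma Upos_Suc: "Upos (Suc n) = Upos n \<union> (\<lambda>i. (i, Suc n, 0)) ` {1..n}"
  by (auto simp: Upos_def image_iff le_Suc_eq)

lemma finite_Tpos [simp]: "finite (Tpos n)"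
proof (induction n)
  case 0
  have "Tpos 0 = {}" by (auto simp: Tpos_def)
  then show ?case by simp
qed (simp add: Tpos_Suc)

lemma finite_Upos [simp]: "finite (Upos n)"
proof (induction n)
  case 0
  have "Upos 0 = {}" by (auto simp: Upos_def)
  then show ?case by simp
qed (simp add: Upos_Suc)

lemma card_Tpos_Upos: "3 * card (Tpos n \<union> Upos n) = n * (n - 1) * (n + 1)"
proof -
  have T: "card (Tpos (Suc n)) = card (Tpos n) + n * n" for n
  proof -
    have "Tpos n \<inter> (\<lambda>(i, j). (i, j, Suc n)) ` ({1..n} \<times> {1..n}) = {}" by (auto simp: Tpos_def)
    then show ?thesis
      unfolding Tpos_Suc by (subst card_Un_disjoint) (auto simp: card_image inj_on_def)
  qed
  have U: "card (Upos (Suc n)) = card (Upos n) + n" for n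
  proof -
    have "Upos n \<inter> (\<lambda>i. (i, Suc n, 0)) ` {1..n} = {}" by (auto simp: Upos_def)
    then show ?thesis
      unfolding Upos_Suc by (subst card_Un_disjoint) (auto simp: card_image inj_on_def)
  qed
  \<comment> \<open>Passing from n to n + 1 adds n * n + n positions. The term n stands on the left
    to avoid truncated subtraction.\<close>
  have "3 * (card (Tpos n) + card (Upos n)) + n = n * n * n" for n
  proof (induction n)
    case 0
    have "Tpos 0 = {}" "Upos 0 = {}" by (auto simp: Tpos_def Upos_def)
    then show ?case by simp
  next
    case (Suc n)
    have "3 * (card (Tpos (Suc n)) + card (Upos (Suc n))) + Suc n
        = (3 * (card (Tpos n) + card (Upos n)) + n) + 3 * (n * n + n) + 1"
      by (simp add: T U)
    also have "\<dots> = Suc n * Suc n * Suc n" unfolding Suc.IH by (simp add: algebra_simps)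
    finally show ?case .
  qed
  moreover have "n * (n - 1) * (n + 1) + n = n * n * n"
    by (cases n) (auto simp: algebra_simps)
  moreover have "card (Tpos n \<union> Upos n) = card (Tpos n) + card (Upos n)"
  proof (rule card_Un_disjoint)
    show "Tpos n \<inter> Upos n = {}" by (auto simp: Tpos_def Upos_def)
  qed simp_all
  ultimately show ?thesis by (metis add_right_cancel)
qed

definition Phi_closure :: "nat \<Rightarrow> (nat \<times> nat \<times> nat) set \<Rightarrow> struct set" where
  "Phi_closure n S = zclosure n (Phi n n ` coordsp S)"

lemma Phi_closure_props:
  shows "zclosed n (Phi_closure n S)" "zirreducible n (Phi_closure n S)"
    and "Phi_closure n S \<subseteq> NilVar n"
proof -
  have "Phi n n ` coordsp S \<subseteq> Str n" "Phi n n ` coordsp S \<subseteq> NilVar n" by (auto simp: Phi_NilVar)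
  then show "zclosed n (Phi_closure n S)" "zirreducible n (Phi_closure n S)"
    "Phi_closure n S \<subseteq> NilVar n"
    unfolding Phi_closure_def
    by (auto intro: zclosed_zclosure zirreducible_image[OF polymap_Phi]
        dest: zclosure_minimal[OF zclosed_NilVar])
qed

lemma Phi_closure_mono: "S \<subseteq> S' \<Longrightarrow> Phi_closure n S \<subseteq> Phi_closure n S'"
proof -
  assume "S \<subseteq> S'"
  then have "coordsp S \<subseteq> coordsp S'" unfolding coordsp_def by blast
  then have "Phi n n ` coordsp S \<subseteq> Phi n n ` coordsp S'" by (rule image_mono)
  then show ?thesis unfolding Phi_closure_def zclosure_def by (intro Inter_anti_mono) auto
qed

lemma NilVar_eq_closure: "NilVar n = Phi_closure n (Tpos n \<union> Upos n)"
proof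
  show "NilVar n \<subseteq> Phi_closure n (Tpos n \<union> Upos n)"
  proof
    fix c assume c: "c \<in> NilVar n"
    let ?D = "Tpos n \<union> Upos n"
    have "p c = 0" if p: "p \<in> polyfun" "\<forall>x\<in>Phi n n ` coordsp ?D. p x = 0" for p
    proof (rule polyfun_vanish_NilVar[OF c p(1)])
      fix s :: struct
      let ?s = "\<lambda>v. if v \<in> ?D then s v else 0 :: complex"
      have "Phi n n s = Phi n n ?s" by (rule Phi_cong) (auto simp: Upos_def)
      moreover have "?s \<in> coordsp ?D" by (simp add: coordsp_def)
      ultimately show "p (Phi n n s) = 0" using p(2) by auto
    qed
    moreover have "Phi n n ` coordsp ?D \<subseteq> Str n" by auto
    ultimately show "c \<in> Phi_closure n ?D"
      using c by (simp add: Phi_closure_def zclosure_eq NilVar_def)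
  qed
qed (rule Phi_closure_props)

text \<open>Expresses that no parameter in \<open>S\<close> is redundant. Pinning the top of the
  chain to \<open>Phi_closure n S\<close> allows a larger set to be appended.\<close>

definition chain_to :: "nat \<Rightarrow> (nat \<times> nat \<times> nat) set \<Rightarrow> bool" where
  "chain_to n S \<longleftrightarrow> (\<exists>Z :: nat \<Rightarrow> struct set.
      (\<forall>i\<le>card S. zclosed n (Z i) \<and> zirreducible n (Z i) \<and> Z i \<subseteq> NilVar n)
      \<and> (\<forall>i<card S. Z i \<subset> Z (Suc i)) \<and> Z (card S) = Phi_closure n S)"

lemma chain_to_empty: "chain_to n {}"
  unfolding chain_to_def using Phi_closure_props[of n "{}"] by auto

lemma chain_to_insert:
  assumes "chain_to n S" "finite S" "v \<notin> S"
    and p: "p \<in> polyfun" "\<And>s. s \<in> coordsp S \<Longrightarrow> p (Phi n n s) = 0"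
    and s: "s \<in> coordsp (insert v S)" "p (Phi n n s) \<noteq> 0"
  shows "chain_to n (insert v S)"
proof -
  obtain Z where Z: "\<forall>i\<le>card S. zclosed n (Z i) \<and> zirreducible n (Z i) \<and> Z i \<subseteq> NilVar n"
      "\<forall>i<card S. Z i \<subset> Z (Suc i)" "Z (card S) = Phi_closure n S"
    using assms(1) unfolding chain_to_def by blast
  have "Phi n n ` coordsp S \<subseteq> Str n" by auto
  then have "Phi n n s \<notin> Phi_closure n S"
    using p s(2) by (auto simp: Phi_closure_def zclosure_eq)
  moreover have "Phi n n s \<in> Phi_closure n (insert v S)"
    using s(1) zclosure_superset[of "Phi n n ` coordsp (insert v S)" n] by (auto simp: Phi_closure_def)
  ultimately have less: "Phi_closure n S \<subset> Phi_closure n (insert v S)"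
    using Phi_closure_mono[of S "insert v S" n] by blast
  let ?Z = "Z(Suc (card S) := Phi_closure n (insert v S))"
  have "card (insert v S) = Suc (card S)" using assms by simp
  then show ?thesis
    unfolding chain_to_def using Z less Phi_closure_props[of n "insert v S"]
    by (intro exI[of _ ?Z]) (auto simp: le_Suc_eq less_Suc_eq)
qed

lemma Phi_stable:
  assumes "k \<le> m" "\<And>i j. 1 \<le> i \<Longrightarrow> i < j \<Longrightarrow> k < j \<Longrightarrow> j \<le> m \<Longrightarrow> s (i, j, 0) = 0"
  shows "Phi n m s = Phi n k s"
  using assms
proof (induction m)
  case (Suc m)
  show ?case
  proof (cases "k = Suc m")
    case False
    have "col (Suc m) s = (\<lambda>i. 0)" using Suc.prems False by (auto simp: col_def fun_eq_iff)
    moreover have "Phi n m s = Phi n k s" using Suc False by simp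
    ultimately show ?thesis by (simp add: tact_zero)
  qed simp
qed simp

text \<open>With all matrix columns zero, \<open>Phi n n\<close> is \<open>trunc n\<close>, so the
  coordinate at \<open>v\<close> itself is the separating function.\<close>

lemma chain_to_Tpos:
  assumes "finite S" "S \<subseteq> Tpos n"
  shows "chain_to n S"
  using assms
proof (induction S)
  case (insert v S)
  have eq: "Phi n n s v = s v" if "s \<in> coordsp (insert v S)" for s
  proof -
    have "s (i, j, 0) = 0" for i j
    proof -
      have "(i, j, 0) \<notin> Tpos n" by (simp add: Tpos_def)
      then show ?thesis using that insert.prems unfolding coordsp_def by blast
    qed
    then have "Phi n n s = trunc n s" using Phi_stable[of 0 n s n] by simp
    then show ?thesis using insert.prems by (simp add: trunc_def)
  qed
  have S: "coordsp S \<subseteq> coordsp (insert v S)" by (auto simp: coordsp_def)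
  have 1: "(\<lambda>w. if w = v then 1 else 0) \<in> coordsp (insert v S)" by (simp add: coordsp_def)
  show ?case
  proof (rule chain_to_insert[of n S v "\<lambda>c. c v", OF _ _ _ pvar _ 1])
    show "Phi n n s v = 0" if "s \<in> coordsp S" for s
    proof -
      have "s v = 0" using that insert.hyps(2) unfolding coordsp_def by blast
      then show ?thesis using eq[of s] S that by auto
    qed
  qed (use insert eq[OF 1] in auto)
qed (rule chain_to_empty)

text \<open>In a triangular algebra, t left multiplications land in \<open>Tail (Suc t)\<close>
  whatever \<open>a\<close> and \<open>y\<close> are. After a change of basis they land in the image
  of that subspace, so the coordinates reveal matrix entries.\<close>

definition lpower :: "nat \<Rightarrow> struct \<Rightarrow> vec \<Rightarrow> nat \<Rightarrow> vec \<Rightarrow> vec" where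
  "lpower n c a t y = (amult n c a ^^ t) y"

lemma lpower_Vsp: "c \<in> Str n \<Longrightarrow> y \<in> Vsp n \<Longrightarrow> lpower n c a t y \<in> Vsp n"
  by (cases t) (auto simp: lpower_def)

lemma lpower_tri:
  assumes "c \<in> tri n" "y \<in> Vsp n" "a \<in> Vsp n"
  shows "lpower n c a t y \<in> Tail (Suc t)"
proof (induction t)
  case 0
  show ?case using VspD[OF assms(2), of 0] by (simp add: lpower_def Tail_def)
next
  case (Suc t)
  have "a \<in> Tail 0" by (simp add: Tail_def)
  from amult_tri_Tail[OF assms(1) this Suc] show ?case by (simp add: lpower_def)
qed

lemma lpower_tact:
  assumes "v \<in> Vsp n" "v k = 0" "c \<in> Str n" "a \<in> Vsp n" "y \<in> Vsp n"
  shows "lpower n (tact n k v c) a t y =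
    transvec k v (lpower n c (transvec k (\<lambda>i. - v i) a) t (transvec k (\<lambda>i. - v i) y))"
proof (induction t)
  case 0
  show ?case using assms by (simp add: lpower_def)
next
  case (Suc t)
  have V: "transvec k (\<lambda>i. - v i) y \<in> Vsp n"
    using linmapD(1)[OF linmap_transvec] assms by simp
  have "lpower n (tact n k v c) a t y \<in> Vsp n" by (rule lpower_Vsp) (use assms in auto)
  then have "lpower n (tact n k v c) a (Suc t) y = transvec k v (amult n c (transvec k (\<lambda>i. - v i) a)
      (transvec k (\<lambda>i. - v i) (lpower n (tact n k v c) a t y)))"
    using assms by (simp add: lpower_def amult_tact)
  also have "transvec k (\<lambda>i. - v i) (lpower n (tact n k v c) a t y) =
      lpower n c (transvec k (\<lambda>i. - v i) a) t (transvec k (\<lambda>i. - v i) y)"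
    using Suc assms(2) by simp
  finally show ?case by (simp add: lpower_def)
qed

lemma polymap_lpower: "polymap (\<lambda>c. lpower n c a t y)"
proof (induction t)
  case 0
  show ?case by (simp add: lpower_def polymap_const)
next
  case (Suc t)
  then show ?case using polymap_amult[OF polymap_id polymap_const Suc] by (simp add: lpower_def)
qed

text \<open>The positions preceding row r of column k when the matrix is read column by column; for
  \<open>r = 1\<close> column k is still empty.\<close>

definition Ulex :: "nat \<Rightarrow> nat \<Rightarrow> (nat \<times> nat \<times> nat) set" where
  "Ulex k r = {(i, j, m). m = 0 \<and> 1 \<le> i \<and> i < j \<and> (j < k \<or> j = k \<and> i < r)}"

text \<open>As long as the columns \<open>j < k\<close> and the first \<open>r - 1\<close> entries of column \<open>k\<close> are the only free
  ones, every unitriangular matrix involved maps \<^term>\<open>Tail k\<close> into the vectors with vanishing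
  coordinates \<open>r, \<dots>, k - 1\<close>.\<close>

lemma lpower_Phi_vanish:
  assumes s: "s \<in> coordsp (Tpos n \<union> Ulex k r)" and k: "1 \<le> k" and "m \<le> n"
    and "a \<in> Vsp n" "y \<in> Vsp n" and "r \<le> i" "i < k"
  shows "lpower n (Phi n m s) a (k - 1) y i = 0"
  using assms(3-)
proof (induction m arbitrary: a y i)
  case 0
  have "lpower n (trunc n s) a (k - 1) y \<in> Tail k"
    using lpower_tri[OF trunc_tri, of y n a s "k - 1"] 0 k by simp
  then show ?case using 0 by (simp add: Tail_def)
next
  case (Suc m)
  let ?v = "col (Suc m) s"
  have v: "?v \<in> Vsp n" "?v (Suc m) = 0" using Suc.prems by auto
  let ?y = "transvec (Suc m) (\<lambda>i. - ?v i) y" and ?a = "transvec (Suc m) (\<lambda>i. - ?v i) a"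
  have V: "?y \<in> Vsp n" "?a \<in> Vsp n"
    using linmapD(1)[OF linmap_transvec[OF uminus_Vsp[OF v(1)]]] Suc.prems by auto
  let ?x = "lpower n (Phi n m s) ?a (k - 1) ?y"
  have x: "?x i = 0" if "r \<le> i" "i < k" for i using Suc.IH[OF _ V(2,1) that] Suc.prems by simp
  have "lpower n (Phi n (Suc m) s) a (k - 1) y = transvec (Suc m) ?v ?x"
    using lpower_tact[OF v Phi_Str] Suc.prems by simp
  \<comment> \<open>An entry of column \<open>Suc m\<close> in a row \<open>i \<ge> r\<close> can be
    free only if \<open>Suc m < k\<close>. Then \<open>Suc m\<close> itself lies between r and k -
    1, where \<open>?x\<close> vanishes already.\<close>
  moreover have "?x (Suc m) * ?v i = 0"
  proof (cases "?v i = 0")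
    case False
    then have i: "1 \<le> i" "i < Suc m" "s (i, Suc m, 0) \<noteq> 0" by (auto simp: col_def split: if_splits)
    then have "(i, Suc m, 0) \<in> Ulex k r" using s by (auto simp: coordsp_def Tpos_def)
    then have "Suc m < k" using Suc.prems by (auto simp: Ulex_def)
    then show ?thesis using x[of "Suc m"] i Suc.prems by simp
  qed simp
  ultimately show ?case using x Suc.prems by (simp add: transvec_def)
qed

lemma chain_to_Ulex_step:
  assumes "1 \<le> r" "r < k" "k \<le> n" "chain_to n (Tpos n \<union> Ulex k r)" "finite (Ulex k r)"
  shows "chain_to n (Tpos n \<union> Ulex k (Suc r))"
proof -
  have eq: "Tpos n \<union> Ulex k (Suc r) = insert (r, k, 0) (Tpos n \<union> Ulex k r)"
    using assms by (auto simp: Ulex_def)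
  \<comment> \<open>The algebra with \<open>e_1 e_i = e_(i+1)\<close> and a single matrix entry at
    row r, column k: the iterated product is \<open>evec k\<close> before the transvection and
    \<open>evec k + evec r\<close> after it.\<close>
  define s :: struct where
    "s = (\<lambda>v. if v = (r, k, 0) \<or> (\<exists>i. 1 \<le> i \<and> i < n \<and> v = (1, i, Suc i)) then 1 else 0)"
  have s: "s \<in> coordsp (insert (r, k, 0) (Tpos n \<union> Ulex k r))"
    by (auto simp: s_def coordsp_def Tpos_def)
  have V: "evec 1 \<in> Vsp n" "evec r \<in> Vsp n" "evec r k = 0" "trunc n s \<in> Str n"
    using assms trunc_tri tri_Str by (auto simp: evec_apply)
  have "col k s = evec r" using assms by (auto simp: col_def s_def evec_def fun_eq_iff)
  moreover have "Phi n (k - 1) s = Phi n 0 s" by (rule Phi_stable) (use assms in \<open>auto simp: s_def\<close>)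
  moreover have "Phi n n s = Phi n k s" by (rule Phi_stable) (use assms in \<open>auto simp: s_def\<close>)
  moreover have "Phi n k s = tact n k (col k s) (Phi n (k - 1) s)" using assms by (cases k) auto
  ultimately have Phi: "Phi n n s = tact n k (evec r) (trunc n s)" by simp
  have lp: "lpower n (trunc n s) (evec 1) t (evec 1) = evec (Suc t)" if "t < n" for t
    using that
  proof (induction t)
    case (Suc t)
    have "amult n (trunc n s) (evec 1) (evec (Suc t)) = evec (Suc (Suc t))"
      using Suc.prems by (subst amult_evec) (auto simp: trunc_def s_def Tpos_def evec_def fun_eq_iff)
    then show ?case using Suc by (simp add: lpower_def)
  qed (simp add: lpower_def)
  have "transvec k (\<lambda>i. - evec r i) (evec 1) = evec 1" using assms by (simp add: transvec_evec)
  then have "lpower n (Phi n n s) (evec 1) (k - 1) (evec 1) = transvec k (evec r) (evec k)"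
    using lpower_tact[OF V(2-4) V(1) V(1), of "k - 1"] lp[of "k - 1"] assms by (simp add: Phi)
  then have nz: "lpower n (Phi n n s) (evec 1) (k - 1) (evec 1) r \<noteq> 0"
    using assms by (simp add: transvec_evec evec_apply)
  show ?thesis
    unfolding eq
  proof (rule chain_to_insert[of _ _ _ "\<lambda>c. lpower n c (evec 1) (k - 1) (evec 1) r", OF assms(4) _ _ _ _ s nz])
    show "(\<lambda>c. lpower n c (evec 1) (k - 1) (evec 1) r) \<in> polyfun"
      by (rule polymapD[OF polymap_lpower])
    show "lpower n (Phi n n s) (evec 1) (k - 1) (evec 1) r = 0"
      if "s \<in> coordsp (Tpos n \<union> Ulex k r)" for s
      by (rule lpower_Phi_vanish[OF that]) (use assms V in auto)
    show "(r, k, 0) \<notin> Tpos n \<union> Ulex k r" by (auto simp: Tpos_def Ulex_def)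
  qed (use assms in auto)
qed

lemma chain_to_NilVar: "chain_to n (Tpos n \<union> Upos n)"
proof -
  have fin: "finite (Ulex k r)" for k r
    by (rule finite_subset[of _ "{..k} \<times> {..k} \<times> {0}"]) (auto simp: Ulex_def)
  have row: "chain_to n (Tpos n \<union> Ulex k (Suc r))"
    if "chain_to n (Tpos n \<union> Ulex k 1)" "Suc r \<le> k" "k \<le> n" for k r
    using that(2)
  proof (induction r)
    case (Suc r)
    then show ?case using chain_to_Ulex_step[of "Suc r" k n] fin that by simp
  qed (use that in simp)
  have "chain_to n (Tpos n \<union> Ulex (Suc k) 1)" if "k \<le> n" for k
    using that
  proof (induction k)
    case 0
    have "Ulex (Suc 0) 1 = {}" by (auto simp: Ulex_def)
    then show ?case using chain_to_Tpos[of "Tpos n" n] by simp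
  next
    case (Suc k)
    \<comment> \<open>Column \<open>Suc k\<close> is complete after k entries, which is the same as
      the next column being empty.\<close>
    have "Ulex (Suc (Suc k)) 1 = Ulex (Suc k) (Suc k)" by (auto simp: Ulex_def)
    then show ?case using row[of "Suc k" k] Suc by simp
  qed
  moreover have "Ulex (Suc n) 1 = Upos n" by (auto simp: Ulex_def Upos_def)
  ultimately show ?thesis by (metis order_refl)
qed

lemma has_zdim_NilVar: "has_zdim n (NilVar n) (n * (n - 1) * (n + 1) div 3)"
proof -
  let ?D = "Tpos n \<union> Upos n"
  have d: "n * (n - 1) * (n + 1) div 3 = card ?D" using card_Tpos_Upos[of n] by simp
  have "zchain n (NilVar n) (card ?D)"
    using chain_to_NilVar[of n] unfolding chain_to_def zchain_def by blast
  moreover have "m \<le> card ?D" if "zchain n (NilVar n) m" for m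
  proof (rule zchain_length_le[OF _ polymap_Phi _ that])
    fix p c assume p: "p \<in> polyfun" "\<And>s. s \<in> coordsp ?D \<Longrightarrow> p (Phi n n s) = 0" "c \<in> NilVar n"
    have "Phi n n ` coordsp ?D \<subseteq> Str n" by auto
    then show "p c = 0" using p by (auto simp: NilVar_eq_closure Phi_closure_def zclosure_eq)
  qed simp
  ultimately show ?thesis unfolding has_zdim_def d using not_less_eq_eq by blast
qed

subsection \<open>Generic triangular structures\<close>

text \<open>In coordinate \<open>Suc i\<close> triangularity leaves only a, b at most i, and
  \<open>y\<close> starts at i, so the sum over b collapses to b = i.\<close>

lemma amult_lead_right:
  assumes c: "c \<in> tri n" and y: "y \<in> Tail i" and i: "i \<in> {1..n}"
  shows "amult n c x y (Suc i) = (\<Sum>a\<in>{1..i}. x a * y i * c (a, i, Suc i))"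
proof -
  have "(\<Sum>b\<in>{1..n}. x a * y b * c (a, b, Suc i)) = (if a \<le> i then x a * y i * c (a, i, Suc i) else 0)" for a
  proof -
    have "(\<Sum>b\<in>{1..n}. x a * y b * c (a, b, Suc i)) =
        (\<Sum>b\<in>{1..n}. if b = i then (if a \<le> i then x a * y i * c (a, i, Suc i) else 0) else 0)"
    proof (intro sum.cong refl)
      fix b
      show "x a * y b * c (a, b, Suc i) =
          (if b = i then (if a \<le> i then x a * y i * c (a, i, Suc i) else 0) else 0)"
        using TailD[OF y, of b] triD[OF c, of "Suc i" a b] by (cases b i rule: linorder_cases) auto
    qed
    then show ?thesis using i by simp
  qed
  then have "amult n c x y (Suc i) = (\<Sum>a\<in>{1..n}. if a \<le> i then x a * y i * c (a, i, Suc i) else 0)"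
    by (simp add: amult_def)
  also have "\<dots> = (\<Sum>a\<in>{1..i}. x a * y i * c (a, i, Suc i))"
    using i by (intro sum.mono_neutral_cong_right) auto
  finally show ?thesis .
qed

text \<open>The left-handed version is the right-handed one in the opposite algebra.\<close>

lemma amult_lead_left:
  assumes c: "c \<in> tri n" and y: "y \<in> Tail i" and i: "i \<in> {1..n}"
  shows "amult n c y x (Suc i) = (\<Sum>a\<in>{1..i}. y i * x a * c (i, a, Suc i))"
proof -
  let ?c = "\<lambda>(i, j, k). c (j, i, k)"
  have "?c \<in> tri n" using c by (auto simp: tri_def Str_def max.commute)
  moreover have "amult n c y x = amult n ?c x y"
    by (rule ext) (simp add: amult_def, subst sum.swap, simp add: mult_ac)
  ultimately show ?thesis using amult_lead_right[of ?c n y i x] y i by (simp add: mult_ac)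
qed

text \<open>For i at least 2, the equation
  \<open>\<Sum>a\<in>{1..i}. alpha c A a * c (a, i, Suc i) = 0\<close> solved for its last unknown;
  the value at index 1 is the one remaining freedom.\<close>

fun alpha :: "struct \<Rightarrow> complex \<Rightarrow> nat \<Rightarrow> complex" where
  "alpha c A i = (if i \<le> 1 then A
     else - (\<Sum>a\<in>{1..<i}. alpha c A a * c (a, i, Suc i)) / c (i, i, Suc i))"

declare alpha.simps [simp del]

section \<open>Iterated squares and triangular changes of basis\<close>

primrec squares :: "nat \<Rightarrow> struct \<Rightarrow> vec \<Rightarrow> nat \<Rightarrow> vec" where
  "squares n c x 0 = x"
| "squares n c x (Suc i) = amult n c (squares n c x i) (squares n c x i)"

lemma squares_Vsp: "c \<in> Str n \<Longrightarrow> x \<in> Vsp n \<Longrightarrow> squares n c x i \<in> Vsp n"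
  by (cases i) auto

lemma squares_Tail:
  assumes "c \<in> tri n" "x \<in> Vsp n"
  shows "squares n c x i \<in> Tail (Suc i)"
proof (induction i)
  case 0
  then show ?case using VspD[OF assms(2), of 0] by (simp add: Tail_def)
next
  case (Suc i)
  then show ?case using amult_tri_Tail[OF assms(1) Suc Suc] by simp
qed

lemma squares_lead:
  assumes "c \<in> tri n" "x \<in> Vsp n" "Suc i < n"
  shows "squares n c x (Suc i) (Suc (Suc i)) =
    (squares n c x i (Suc i))\<^sup>2 * c (Suc i, Suc i, Suc (Suc i))"
proof -
  let ?y = "squares n c x i"
  have y: "?y \<in> Tail (Suc i)" by (rule squares_Tail[OF assms(1,2)])
  have "amult n c ?y ?y (Suc (Suc i)) = (\<Sum>a\<in>{1..Suc i}. ?y a * ?y (Suc i) * c (a, Suc i, Suc (Suc i)))"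
    by (rule amult_lead_right[OF assms(1) y]) (use assms(3) in auto)
  also have "\<dots> = (\<Sum>a\<in>{1..Suc i}. if a = Suc i then ?y a * ?y (Suc i) * c (a, Suc i, Suc (Suc i)) else 0)"
    using TailD[OF y] by (intro sum.cong refl) auto
  also have "\<dots> = (?y (Suc i))\<^sup>2 * c (Suc i, Suc i, Suc (Suc i))"
    by (simp add: power2_eq_square)
  finally show ?thesis by simp
qed

definition lincomb :: "nat \<Rightarrow> (nat \<Rightarrow> vec) \<Rightarrow> vec \<Rightarrow> vec" where
  "lincomb n f x = (\<lambda>t. \<Sum>i\<in>{1..n}. x i * f i t)"

lemma linmap_lincomb: "(\<And>i. i \<in> {1..n} \<Longrightarrow> f i \<in> Vsp n) \<Longrightarrow> linmap n (lincomb n f)"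
  by (auto simp: linmap_def lincomb_def Vsp_def fun_eq_iff sum.distrib sum_distrib_left algebra_simps)

lemma lincomb_evec: "i \<in> {1..n} \<Longrightarrow> lincomb n f (evec i) = f i"
  by (rule ext) (simp add: lincomb_def evec_apply if_distrib[of "\<lambda>x. x * _"] cong: if_cong)

lemma lincomb_lead:
  assumes "\<And>i. i \<in> {1..n} \<Longrightarrow> f i \<in> Tail i" "x \<in> Tail k" "k \<in> {1..n}"
  shows "lincomb n f x \<in> Tail k" "lincomb n f x k = x k * f k k"
proof -
  have z: "x i * f i t = 0" if "t \<le> k" "t < k \<or> i \<noteq> k" "i \<in> {1..n}" for i t
    using that TailD[OF assms(2), of i] TailD[OF assms(1)[OF that(3)], of t]
    by (cases i k rule: linorder_cases) auto
  show "lincomb n f x \<in> Tail k"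
    unfolding lincomb_def using z by (intro TailI sum.neutral) auto
  have "lincomb n f x k = (\<Sum>i\<in>{1..n}. if i = k then x k * f k k else 0)"
    unfolding lincomb_def using z by (intro sum.cong refl) auto
  then show "lincomb n f x k = x k * f k k" using assms(3) by simp
qed

text \<open>The matrix is lower triangular with nonzero diagonal. Its inverse is again lower
  triangular with reciprocal diagonal, which is all that is needed to read off leading structure
  constants.\<close>

lemma lincomb_bij:
  assumes f: "\<And>i. i \<in> {1..n} \<Longrightarrow> f i \<in> Vsp n" "\<And>i. i \<in> {1..n} \<Longrightarrow> f i \<in> Tail i"
    "\<And>i. i \<in> {1..n} \<Longrightarrow> f i i \<noteq> 0"
  shows "bij_betw (lincomb n f) (Vsp n) (Vsp n)"
    and "\<And>k y. k \<in> {1..n} \<Longrightarrow> y \<in> Vsp n \<Longrightarrow> y \<in> Tail k \<Longrightarrow>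
      inv_into (Vsp n) (lincomb n f) y \<in> Tail k \<and> inv_into (Vsp n) (lincomb n f) y k = y k / f k k"
proof -
  let ?L = "lincomb n f"
  have lin: "linmap n ?L" using f(1) by (rule linmap_lincomb)
  have big: "y = 0" if "y \<in> Vsp n" "y \<in> Tail (Suc n)" for y
    using that by (auto simp: Vsp_def Tail_def fun_eq_iff) (metis not_less_eq_eq not_le)
  \<comment> \<open>Back substitution from position n down to k; keeping the preimage inside
    \<open>Tail k\<close> is what yields the claim about the inverse.\<close>
  have surj: "\<exists>x\<in>Vsp n \<inter> Tail k. ?L x = y" if "y \<in> Vsp n" "y \<in> Tail k" "1 \<le> k" "k \<le> Suc n" for y k
    using that(4,1,2,3)
  proof (induction k arbitrary: y rule: inc_induct)
    case base
    then have "?L 0 = y" using big[of y] linmap_zero[OF lin] by simp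
    moreover have "0 \<in> Vsp n \<inter> Tail (Suc n)" by (simp add: Tail_def)
    ultimately show ?case by blast
  next
    case (step k)
    then have k: "k \<in> {1..n}" by auto
    define b where "b = y k / f k k"
    define y' where "y' = (\<lambda>t. y t - b * f k t)"
    have "y' \<in> Vsp n" using step.prems f(1)[OF k] by (auto simp: y'_def Vsp_def)
    moreover have "y' \<in> Tail (Suc k)"
      using step.prems f(2,3)[OF k] by (auto simp: y'_def b_def Tail_def less_Suc_eq)
    ultimately obtain x where x: "x \<in> Vsp n" "x \<in> Tail (Suc k)" "?L x = y'"
      using step.IH[of y'] by auto
    have e: "(\<lambda>t. b * evec k t) \<in> Vsp n" "evec k \<in> Vsp n" using k scale_Vsp evec_Vsp by blast+
    have "?L (x + (\<lambda>t. b * evec k t)) = y' + (\<lambda>t. b * f k t)"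
      using linmapD(2)[OF lin x(1) e(1)] linmapD(3)[OF lin e(2)] x(3) lincomb_evec[OF k, of f] by simp
    also have "\<dots> = y" by (auto simp: y'_def)
    finally have "?L (x + (\<lambda>t. b * evec k t)) = y" .
    moreover have "x + (\<lambda>t. b * evec k t) \<in> Vsp n \<inter> Tail k"
      using x e by (auto simp: Tail_def evec_apply)
    ultimately show ?case by blast
  qed
  have ker: "x = 0" if x: "x \<in> Vsp n" "?L x = 0" for x
  proof -
    have "x \<in> Tail (Suc k)" if "k \<le> n" for k
      using that
    proof (induction k)
      case 0
      then show ?case using VspD[OF x(1), of 0] by (simp add: Tail_def)
    next
      case (Suc k)
      then have k: "Suc k \<in> {1..n}" and T: "x \<in> Tail (Suc k)" by auto
      have "?L x (Suc k) = x (Suc k) * f (Suc k) (Suc k)"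
        by (rule lincomb_lead(2)[OF f(2) T k]) auto
      then have "x (Suc k) = 0" using x(2) f(3)[OF k] by simp
      then show ?case using T by (auto simp: Tail_def less_Suc_eq)
    qed
    then show ?thesis using big x by blast
  qed
  have inj: "inj_on ?L (Vsp n)"
  proof (rule inj_onI)
    fix x y assume xy: "x \<in> Vsp n" "y \<in> Vsp n" "?L x = ?L y"
    let ?y = "\<lambda>t. (- 1) * y t"
    have y: "?y \<in> Vsp n" using xy(2) by (rule scale_Vsp)
    have "?L (x + ?y) = 0"
      using linmapD(2)[OF lin xy(1) y] linmapD(3)[OF lin xy(2), of "-1"] xy(3)
      by (simp add: fun_eq_iff)
    then have "x + ?y = 0" using ker add_Vsp[OF xy(1) y] by blast
    then show "x = y" by (simp add: fun_eq_iff)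
  qed
  have T1: "y \<in> Tail 1" if "y \<in> Vsp n" for y using VspD[OF that, of 0] by (simp add: Tail_def)
  have "Vsp n \<subseteq> ?L ` Vsp n" using surj[of _ 1] T1 by fastforce
  then show bij: "bij_betw ?L (Vsp n) (Vsp n)"
    using inj linmapD(1)[OF lin] by (auto simp: bij_betw_def)
  fix k y assume k: "k \<in> {1..n}" and y: "y \<in> Vsp n" "y \<in> Tail k"
  obtain x where x: "x \<in> Vsp n" "x \<in> Tail k" "?L x = y" using surj[OF y] k by auto
  have "inv_into (Vsp n) ?L y = x" using x inj by (metis inv_into_f_f)
  then show "inv_into (Vsp n) ?L y \<in> Tail k \<and> inv_into (Vsp n) ?L y k = y k / f k k"
    using x(2,3) lincomb_lead(2)[OF f(2) x(2) k] f(3)[OF k] by auto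
qed

text \<open>Take \<open>f\<^sub>1 = \<Sum>\<^sub>j \<alpha>\<^sub>j e\<^sub>j\<close> and \<open>f\<^sub>i\<^sub>+\<^sub>1 = f\<^sub>i\<^sup>2\<close>. The leading coefficient of \<open>f\<^sub>1 f\<^sub>i\<close> is a multiple of
  \<open>\<Sum>\<^sub>j\<^sub>\<le>\<^sub>i \<alpha>\<^sub>j c\<^sub>j\<^sub>i\<^sup>i\<^sup>+\<^sup>1\<close>, which \<^const>\<open>alpha\<close> makes zero, and the choice of \<open>\<alpha>\<^sub>1\<close> normalizes
  \<open>c\<^sub>2\<^sub>1\<^sup>3\<close>.\<close>

lemma generic_tri_Rfam:
  assumes c: "c \<in> tri n" and n: "n \<ge> 3"
    and diag: "\<And>i. 1 \<le> i \<Longrightarrow> i < n \<Longrightarrow> c (i, i, Suc i) \<noteq> 0"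
    and ne: "c (2, 1, 3) \<noteq> c (1, 2, 3)"
  shows "\<exists>c'\<in>Rfam n. c \<in> orbit n c'"
proof -
  \<comment> \<open>Forced by the normalization: \<open>f 2\<close> times \<open>f 1\<close> has
    third coordinate \<open>f 2 2 * A * (c (2, 1, 3) - c (1, 2, 3))\<close>, which must equal
    \<open>f 3 3\<close>, that is
    \<open>f 2 2 * A\<^sup>2 * c (1, 1, 2) * c (2, 2, 3)\<close>.\<close>
  define A where "A = (c (2, 1, 3) - c (1, 2, 3)) / (c (1, 1, 2) * c (2, 2, 3))"
  have d12: "c (1, 1, 2) \<noteq> 0" "c (2, 2, 3) \<noteq> 0"
    using diag[of 1] diag[of 2] n by (simp_all add: numeral_2_eq_2 numeral_3_eq_3)
  have A: "A \<noteq> 0" using ne d12 by (simp add: A_def)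
  define x :: vec where "x = (\<lambda>i. if i \<in> {1..n} then alpha c A i else 0)"
  have x: "x \<in> Vsp n" by (auto simp: x_def Vsp_def)
  have x1: "x 1 = A" using n by (simp add: x_def alpha.simps)
  have xsum: "(\<Sum>a\<in>{1..i}. x a * c (a, i, Suc i)) = 0" if i: "2 \<le> i" "i < n" for i
  proof -
    have "{1..i} = insert i {1..<i}" using i by auto
    then have "(\<Sum>a\<in>{1..i}. x a * c (a, i, Suc i)) =
        alpha c A i * c (i, i, Suc i) + (\<Sum>a\<in>{1..<i}. alpha c A a * c (a, i, Suc i))"
      using i by (simp add: x_def)
    also have "\<dots> = 0" using diag[of i] i by (subst alpha.simps) simp
    finally show ?thesis .
  qed
  have cS: "c \<in> Str n" using c by (rule tri_Str)
  define f where "f i = squares n c x (i - 1)" for i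
  have fV: "f i \<in> Vsp n" for i using squares_Vsp[OF cS x] by (simp add: f_def)
  have fT: "f i \<in> Tail i" if "i \<ge> 1" for i using squares_Tail[OF c x, of "i - 1"] that by (simp add: f_def)
  have f1: "f 1 = x" by (simp add: f_def)
  have fS: "f (Suc i) = amult n c (f i) (f i)" if "i \<ge> 1" for i
    using that by (cases i) (auto simp: f_def)
  have fl: "f (Suc i) (Suc i) = (f i i)\<^sup>2 * c (i, i, Suc i)" if "1 \<le> i" "i < n" for i
    using squares_lead[OF c x, of "i - 1"] that by (cases i) (auto simp: f_def)
  have fd: "f i i \<noteq> 0" if "1 \<le> i" "i \<le> n" for i
    using that
  proof (induction i rule: dec_induct)
    case base
    show ?case using A x1 by (simp add: f1[unfolded One_nat_def])
  next
    case (step i)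
    then show ?case using fl[of i] diag[of i] by simp
  qed
  let ?L = "lincomb n f"
  let ?I = "inv_into (Vsp n) ?L"
  have bij: "bij_betw ?L (Vsp n) (Vsp n)" by (rule lincomb_bij(1)) (use fV fT fd in auto)
  have inv: "?I y \<in> Tail k \<and> ?I y k = y k / f k k" if "k \<in> {1..n}" "y \<in> Vsp n" "y \<in> Tail k" for k y
    by (rule lincomb_bij(2)) (use fV fT fd that in auto)
  have lin: "linmap n ?L" "linmap n ?I"
    using linmap_lincomb linmap_inv_into[OF _ bij] fV by blast+
  \<comment> \<open>The structure constants with respect to the basis \<open>f\<close>:
    \<open>?L\<close> sends coordinates to vectors.\<close>
  define c' where "c' = transport n ?I ?L c"
  have "c' \<in> orbit n c"
    unfolding c'_def using bij_betw_inv_into_right[OF bij] bij_betw_inv_into_left[OF bij]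
    by (intro transport_orbit[OF cS lin(2,1)]) auto
  then have orb: "c \<in> orbit n c'" using orbit_sym[OF cS] by blast
  have c': "c' (i, j, m) = ?I (amult n c (f i) (f j)) m" if "i \<in> {1..n}" "j \<in> {1..n}" for i j m
  proof -
    have "amult n c' (evec i) (evec j) = ?I (amult n c (f i) (f j))"
      unfolding c'_def using amult_transport[OF lin(2,1) cS evec_Vsp[OF that(1)] evec_Vsp[OF that(2)]]
      by (simp only: lincomb_evec[OF that(1)] lincomb_evec[OF that(2)])
    then show ?thesis using amult_evec[OF that, of c'] by (metis (no_types))
  qed
  have c'S: "c' \<in> Str n" by (simp add: c'_def)
  have prodT: "amult n c (f i) (f j) \<in> Tail (Suc (max i j))" if "i \<ge> 1" "j \<ge> 1" for i j
    using amult_tri_Tail[OF c fT[OF that(1)] fT[OF that(2)]] .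
  have low: "c' (i, j, k) = 0" if "k \<le> max i j" for i j k
  proof (cases "i \<in> {1..n} \<and> j \<in> {1..n}")
    case True
    let ?y = "amult n c (f i) (f j)" and ?m = "max i j"
    have "?y \<in> Tail (Suc ?m)" using prodT True by auto
    \<comment> \<open>The product lies one step deeper, but \<open>Suc ?m\<close> may be n + 1, out
      of reach of \<open>inv\<close>. Hence \<open>inv\<close> is used at \<open>?m\<close>, where
      the coordinate of the product is zero.\<close>
    moreover from this have "?y \<in> Tail ?m" by (rule subsetD[OF Tail_mono[OF le_SucI[OF order_refl]]])
    moreover have "?m \<in> {1..n}" using True by auto
    ultimately have "?I ?y \<in> Tail ?m" "?I ?y ?m = 0"
      using inv[of ?m ?y] amult_Vsp[OF cS] by (auto simp: TailD)
    then show ?thesis using c' True that TailD[of "?I ?y" ?m k] by (cases "k = ?m") auto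
  qed (use StrD[OF c'S] in blast)
  have sq: "c' (i, i, k) = (if k = i + 1 then 1 else 0)" if "1 \<le> i \<and> i \<le> n - 1" for i k
  proof -
    have i: "i \<in> {1..n}" "Suc i \<in> {1..n}" using that n by auto
    have "?I (amult n c (f i) (f i)) = ?I (?L (evec (Suc i)))"
      using lincomb_evec[OF i(2), of f] fS[of i] that by simp
    also have "\<dots> = evec (Suc i)" using bij_betw_inv_into_left[OF bij evec_Vsp[OF i(2)]] .
    finally show ?thesis using c'[OF i(1) i(1)] by (simp add: evec_apply)
  qed
  have lead: "c' (i, j, Suc (max i j)) = amult n c (f i) (f j) (Suc (max i j)) / f (Suc (max i j)) (Suc (max i j))"
    if "i \<in> {1..n}" "j \<in> {1..n}" "max i j < n" for i j
    using c'[OF that(1,2)] inv[of "Suc (max i j)" "amult n c (f i) (f j)"] prodT[of i j] that amult_Vsp[OF cS]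
    by auto
  have row: "c' (1, i, i + 1) = 0" if "2 \<le> i \<and> i \<le> n - 1" for i
  proof -
    have i: "i \<in> {1..n}" "1 \<le> i" "i < n" "2 \<le> i" using that n by auto
    have "amult n c x (f i) (Suc i) = (\<Sum>a\<in>{1..i}. x a * f i i * c (a, i, Suc i))"
      by (rule amult_lead_right[OF c fT[OF i(2)] i(1)])
    also have "\<dots> = f i i * (\<Sum>a\<in>{1..i}. x a * c (a, i, Suc i))"
      by (simp add: sum_distrib_left mult_ac)
    also have "\<dots> = 0" using xsum[OF i(4,3)] by simp
    finally show ?thesis using lead[of 1 i] i n f1 by (simp add: max_def)
  qed
  have "c' (2, 1, 3) = 1"
  proof -
    have s3: "Suc 2 = (3 :: nat)" "{Suc 0..2} = {1, 2}" by auto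
    have two: "2 \<in> {1..n}" using n by auto
    have "amult n c (f 2) x (Suc 2) = (\<Sum>a\<in>{1..2}. f 2 2 * x a * c (2, a, Suc 2))"
      by (rule amult_lead_left[OF c fT two]) simp
    then have "amult n c (f 2) x 3 = f 2 2 * (x 1 * c (2, 1, 3) + x 2 * c (2, 2, 3))"
      by (simp add: s3 algebra_simps)
    moreover have "x 1 * c (1, 2, 3) + x 2 * c (2, 2, 3) = 0"
      using xsum[of 2] n by (simp add: s3)
    then have "x 2 * c (2, 2, 3) = - (A * c (1, 2, 3))" using x1 by (simp add: eq_neg_iff_add_eq_0 add.commute)
    ultimately have 1: "amult n c (f 2) x 3 = f 2 2 * (A * (c (2, 1, 3) - c (1, 2, 3)))"
      using x1 by (simp add: algebra_simps)
    have f2: "f 2 2 = A\<^sup>2 * c (1, 1, 2)" using fl[of 1] n f1 x1 by (simp add: numeral_2_eq_2)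
    have f3: "f 3 3 = (f 2 2)\<^sup>2 * c (2, 2, 3)" using fl[of 2] n by (simp add: numeral_3_eq_3 numeral_2_eq_2)
    have "A * (c (2, 1, 3) - c (1, 2, 3)) = f 2 2 * c (2, 2, 3)"
      using d12 by (simp add: f2 A_def power2_eq_square)
    then have "amult n c (f 2) x 3 = f 3 3" using 1 f3 by (simp add: power2_eq_square)
    then show ?thesis using lead[of 2 1] n f1 fd[of 3] by (simp add: numeral_3_eq_3)
  qed
  then have "c' \<in> Rfam n" unfolding Rfam_def using c'S low sq row by auto
  then show ?thesis using orb by blast
qed

section \<open>Genericity of the family\<close>

lemma Rfam_tri: "Rfam n \<subseteq> tri n"
  by (auto simp: Rfam_def tri_def)

lemma generic_Rfam:
  assumes n: "n \<ge> 3"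
  shows "generic n (Rfam n) (NilVar n)"
  unfolding generic_def
proof
  let ?O = "\<Union>c\<in>Rfam n. orbit n c"
  have "?O \<subseteq> NilVar n" using NilVar_orbit[OF tri_NilVar] Rfam_tri by blast
  then show "zclosure n ?O \<subseteq> NilVar n" by (rule zclosure_minimal[OF zclosed_NilVar])
  have OS: "?O \<subseteq> Str n" by (auto simp: orbit_def)
  \<comment> \<open>Nonvanishing of \<open>q\<close> encodes the two genericity conditions of
    \<open>generic_tri_Rfam\<close>.\<close>
  define q where "q c = (c (2, 1, 3) - c (1, 2, 3)) * (\<Prod>i\<in>{1..<n}. c (i, i, Suc i))"
    for c :: struct
  have q: "(\<lambda>s. q (trunc n s)) \<in> polyfun"
  proof (rule polyfun_comp[of q])
    show "q \<in> polyfun"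
      unfolding q_def[abs_def] by (intro pmult polyfun_prod polyfun_diff pvar)
    show "polymap (trunc n)" using polymap_Phi[of n 0] by (simp add: polymap_def)
  qed
  \<comment> \<open>The algebra with \<open>e_i e_i = e_(i+1)\<close> and
    \<open>e_2 e_1 = e_3\<close> shows that \<open>q\<close> is not identically zero.\<close>
  define s0 :: struct where "s0 = (\<lambda>(i, j, k). if i = j \<and> k = Suc i \<or> (i, j, k) = (2, 1, 3) then 1 else 0)"
  have q0: "q (trunc n s0) \<noteq> 0" using n by (simp add: q_def trunc_def Tpos_def s0_def)
  have good: "\<exists>c'\<in>Rfam n. Phi n n s \<in> orbit n c'" if s: "q (trunc n s) \<noteq> 0" for s
  proof -
    have "\<exists>c'\<in>Rfam n. trunc n s \<in> orbit n c'"
      by (rule generic_tri_Rfam[OF trunc_tri n]) (use s in \<open>auto simp: q_def\<close>)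
    then show ?thesis using orbit_trans Phi_orbit[of n n s] by blast
  qed
  show "NilVar n \<subseteq> zclosure n ?O"
  proof
    fix c assume c: "c \<in> NilVar n"
    have "p c = 0" if p: "p \<in> polyfun" "\<forall>x\<in>?O. p x = 0" for p
    proof (rule polyfun_vanish_NilVar[OF c p(1)])
      fix s
      show "p (Phi n n s) = 0"
      proof (rule ccontr)
        assume "p (Phi n n s) \<noteq> 0"
        \<comment> \<open>A polynomial that is nonzero somewhere on the image is nonzero at some
          point with generic triangular part, because the parameter space is irreducible.\<close>
        then obtain s' where "p (Phi n n s') \<noteq> 0" "q (trunc n s') \<noteq> 0"
          using polyfun_coordsp_domain[OF polyfun_comp[OF p(1) polymap_Phi[of n n]] _ _ q, of s UNIV s0] q0
          by (auto simp: coordsp_def)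
        then show False using good p(2) by blast
      qed
    qed
    then show "c \<in> zclosure n ?O" using c OS by (simp add: zclosure_eq NilVar_def)
  qed
qed

theorem theoremA:
  shows "(\<forall>n::nat. n \<ge> 3 \<longrightarrow> generic n (Rfam n) (NilVar n))
       \<and> (\<forall>n::nat. n \<ge> 2 \<longrightarrow> zirreducible n (NilVar n)
            \<and> has_zdim n (NilVar n) (n * (n - 1) * (n + 1) div 3))"
  using generic_Rfam has_zdim_NilVar NilVar_eq_closure Phi_closure_props(2) by metis

end
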